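(* Let $\pi$ be a group and $f\colon A\to K(\pi,1)$ a map. Then $G_1^f(K(\pi,1))=\mathcal{Z}_\pi f_*(\pi_1(A))$.
   Context: All spaces are path-connected with the homotopy type of CW-complexes; maps and homotopies are based. For $f\colon A\to X$ and $m\ge 1$, the $m$-th generalized Gottlieb group $G_m^f(X)$ is the subgroup of $\pi_m(X)$ consisting of all elements which can be represented by a map $\alpha\colon\mathbb{S}^m\to X$ such that $f\vee\alpha\colon A\vee\mathbb{S}^m\to X$ extends (up to homotopy) to a map $A\times\mathbb{S}^m\to X$. $K(\pi,1)$ is an Eilenberg–MacLane space, $f_*\colon\pi_1(A)\to\pi_1(K(\pi,1))=\pi$ is the induced homomorphism, and for a subgroup $S$ of a group $G$, $\mathcal{Z}_G S$ denotes the centralizer of $S$ in $G$. *)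

theory Defs
  imports "HOL-Analysis.Analysis" "HOL-Algebra.Group"
begin

section \<open>CW-complexes\<close>

text \<open>The closed unit disc in \<open>\<real>\<^sup>n\<close>, its interior and its boundary sphere, with \<open>\<real>\<^sup>n\<close> rendered as
  \<^const>\<open>Euclidean_space\<close> (real sequences vanishing from index \<open>n\<close> on).
  For \<open>n = 0\<close> the disc and its interior are a point and the boundary is empty.\<close>

definition disc :: "nat \<Rightarrow> (nat \<Rightarrow> real) topology" where
  "disc n = subtopology (Euclidean_space n) {x. (\<Sum>i<n. (x i)\<^sup>2) \<le> 1}"

definition disc_interior :: "nat \<Rightarrow> (nat \<Rightarrow> real) set" where
  "disc_interior n = {x \<in> topspace (disc n). (\<Sum>i<n. (x i)\<^sup>2) < 1}"

definition disc_boundary :: "nat \<Rightarrow> (nat \<Rightarrow> real) set" where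
  "disc_boundary n = {x \<in> topspace (disc n). (\<Sum>i<n. (x i)\<^sup>2) = 1}"

text \<open>Whitehead's definition. The open cells, being nonempty and pairwise disjoint, serve as their
  own index set: \<open>E\<close> is the set of open cells, \<open>d e\<close> the dimension and \<open>\<Phi> e\<close> a characteristic
  map of the cell \<open>e\<close>. The last two clauses are closure-finiteness and the weak topology.\<close>

definition CW_complex :: "'a topology \<Rightarrow> bool" where
  "CW_complex X \<longleftrightarrow> Hausdorff_space X \<and>
    (\<exists>(E :: 'a set set) (d :: 'a set \<Rightarrow> nat) (\<Phi> :: 'a set \<Rightarrow> (nat \<Rightarrow> real) \<Rightarrow> 'a).
      pairwise disjnt E \<and> \<Union>E = topspace X \<and>
      (\<forall>e\<in>E. continuous_map (disc (d e)) X (\<Phi> e) \<and>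
             homeomorphic_map (subtopology (disc (d e)) (disc_interior (d e)))
                              (subtopology X e) (\<Phi> e)) \<and>
      (\<forall>e\<in>E. \<exists>F. finite F \<and> F \<subseteq> E \<and> (\<forall>c\<in>F. d c < d e) \<and>
                 \<Phi> e ` disc_boundary (d e) \<subseteq> \<Union>F) \<and>
      (\<forall>C. C \<subseteq> topspace X \<longrightarrow>
           (closedin X C \<longleftrightarrow>
            (\<forall>e\<in>E. closedin (disc (d e)) {x \<in> topspace (disc (d e)). \<Phi> e x \<in> C}))))"


section \<open>Homotopy groups\<close>

definition sphere_base :: "nat \<Rightarrow> real" where
  "sphere_base = (\<lambda>i. if i = 0 then 1 else 0)"

definition based_map :: "'a topology \<Rightarrow> 'a \<Rightarrow> 'b topology \<Rightarrow> 'b \<Rightarrow> ('a \<Rightarrow> 'b) \<Rightarrow> bool" where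
  "based_map A a\<^sub>0 X x\<^sub>0 f \<longleftrightarrow> continuous_map A X f \<and> f a\<^sub>0 = x\<^sub>0"

definition based_homotopic ::
    "'a topology \<Rightarrow> 'a \<Rightarrow> 'b topology \<Rightarrow> 'b \<Rightarrow> ('a \<Rightarrow> 'b) \<Rightarrow> ('a \<Rightarrow> 'b) \<Rightarrow> bool" where
  "based_homotopic A a\<^sub>0 X x\<^sub>0 = homotopic_with (\<lambda>h. h a\<^sub>0 = x\<^sub>0) A X"

definition sphere_class ::
    "nat \<Rightarrow> 'a topology \<Rightarrow> 'a \<Rightarrow> ((nat \<Rightarrow> real) \<Rightarrow> 'a) \<Rightarrow> ((nat \<Rightarrow> real) \<Rightarrow> 'a) set" where
  "sphere_class m X x\<^sub>0 \<alpha> = {\<beta>. based_homotopic (nsphere m) sphere_base X x\<^sub>0 \<alpha> \<beta>}"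

text \<open>The underlying set of \<open>\<pi>\<^sub>m(X, x\<^sub>0)\<close>. Only for \<open>m = 1\<close> is the group structure introduced below.\<close>

definition homotopy_classes :: "nat \<Rightarrow> 'a topology \<Rightarrow> 'a \<Rightarrow> ((nat \<Rightarrow> real) \<Rightarrow> 'a) set set" where
  "homotopy_classes m X x\<^sub>0 =
     sphere_class m X x\<^sub>0 ` {\<alpha>. based_map (nsphere m) sphere_base X x\<^sub>0 \<alpha>}"

text \<open>Angle doubling \<open>z \<mapsto> z\<^sup>2\<close> on the unit circle, where \<open>z\<close> stands for \<open>z\<^sub>0 + \<i> z\<^sub>1\<close>. Running through
  \<open>\<alpha>\<close> on the upper and \<open>\<beta>\<close> on the lower half circle is the concatenation \<open>\<alpha>\<close> followed by \<open>\<beta>\<close>.\<close>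

definition circle_double :: "(nat \<Rightarrow> real) \<Rightarrow> nat \<Rightarrow> real" where
  "circle_double z = (\<lambda>i. if i = 0 then (z 0)\<^sup>2 - (z 1)\<^sup>2 else if i = 1 then 2 * z 0 * z 1 else 0)"

definition loop_concat ::
    "((nat \<Rightarrow> real) \<Rightarrow> 'a) \<Rightarrow> ((nat \<Rightarrow> real) \<Rightarrow> 'a) \<Rightarrow> (nat \<Rightarrow> real) \<Rightarrow> 'a" where
  "loop_concat \<alpha> \<beta> = (\<lambda>z. if 0 \<le> z 1 then \<alpha> (circle_double z) else \<beta> (circle_double z))"

definition fundamental_group :: "'a topology \<Rightarrow> 'a \<Rightarrow> ((nat \<Rightarrow> real) \<Rightarrow> 'a) set monoid" where
  "fundamental_group X x\<^sub>0 =
     \<lparr>carrier = homotopy_classes 1 X x\<^sub>0,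
      mult = (\<lambda>U V. \<Union>\<alpha>\<in>U. \<Union>\<beta>\<in>V. sphere_class 1 X x\<^sub>0 (loop_concat \<alpha> \<beta>)),
      one = sphere_class 1 X x\<^sub>0 (\<lambda>_. x\<^sub>0)\<rparr>"

text \<open>The map \<open>f\<^sub>*\<close> induced on fundamental groups by a based map \<open>f\<close> into \<open>(X, x\<^sub>0)\<close>.\<close>

definition induced_hom ::
    "'b topology \<Rightarrow> 'b \<Rightarrow> ('a \<Rightarrow> 'b) \<Rightarrow> ((nat \<Rightarrow> real) \<Rightarrow> 'a) set \<Rightarrow> ((nat \<Rightarrow> real) \<Rightarrow> 'b) set" where
  "induced_hom X x\<^sub>0 f U = (\<Union>\<alpha>\<in>U. sphere_class 1 X x\<^sub>0 (f \<circ> \<alpha>))"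

definition Eilenberg_MacLane_1 :: "('g, 'm) monoid_scheme \<Rightarrow> 'a topology \<Rightarrow> 'a \<Rightarrow> bool" where
  "Eilenberg_MacLane_1 G X x\<^sub>0 \<longleftrightarrow>
     path_connected_space X \<and> x\<^sub>0 \<in> topspace X \<and> fundamental_group X x\<^sub>0 \<cong> G \<and>
     (\<forall>n\<ge>2. homotopy_classes n X x\<^sub>0 = {sphere_class n X x\<^sub>0 (\<lambda>_. x\<^sub>0)})"


section \<open>Generalized Gottlieb groups\<close>

text \<open>The wedge \<open>A \<or> B\<close> as the subspace \<open>A \<times> {b\<^sub>0} \<union> {a\<^sub>0} \<times> B\<close> of the product (for arbitrary spaces
  this carries the quotient topology of the one-point union).\<close>

definition wedge :: "'a topology \<Rightarrow> 'a \<Rightarrow> 'b topology \<Rightarrow> 'b \<Rightarrow> ('a \<times> 'b) topology" where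
  "wedge A a\<^sub>0 B b\<^sub>0 =
     subtopology (prod_topology A B) (topspace A \<times> {b\<^sub>0} \<union> {a\<^sub>0} \<times> topspace B)"

definition wedge_map :: "'b \<Rightarrow> ('a \<Rightarrow> 'c) \<Rightarrow> ('b \<Rightarrow> 'c) \<Rightarrow> 'a \<times> 'b \<Rightarrow> 'c" where
  "wedge_map b\<^sub>0 f g = (\<lambda>(a, b). if b = b\<^sub>0 then f a else g b)"

definition Gottlieb ::
    "nat \<Rightarrow> 'a topology \<Rightarrow> 'a \<Rightarrow> 'b topology \<Rightarrow> 'b \<Rightarrow> ('a \<Rightarrow> 'b) \<Rightarrow> ((nat \<Rightarrow> real) \<Rightarrow> 'b) set set" where
  "Gottlieb m A a\<^sub>0 X x\<^sub>0 f =
     {c \<in> homotopy_classes m X x\<^sub>0.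
        \<exists>\<alpha>\<in>c. \<exists>F. continuous_map (prod_topology A (nsphere m)) X F \<and>
          based_homotopic (wedge A a\<^sub>0 (nsphere m) sphere_base) (a\<^sub>0, sphere_base) X x\<^sub>0
            F (wedge_map sphere_base f \<alpha>)}"


section \<open>Centralizers\<close>

definition centralizer :: "('g, 'm) monoid_scheme \<Rightarrow> 'g set \<Rightarrow> 'g set" where
  "centralizer G S = {g \<in> carrier G. \<forall>s\<in>S. g \<otimes>\<^bsub>G\<^esub> s = s \<otimes>\<^bsub>G\<^esub> g}"

end

theory Submission
  imports Defs
begin

text \<open>
  A map \<open>F : A \<times> S\<^sup>1 \<rightarrow> X\<close> that restricts to \<open>f\<close> on \<open>A\<close> is a family of loops, the loop over \<open>a\<close> being based
  at \<open>f a\<close>; the theorem says when the loop \<open>\<alpha>\<close> over the base point spreads to such a family.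

  \<^emph>\<open>Gottlieb elements are central.\<close> Composing \<open>F\<close> with a loop \<open>p\<close> of \<open>A\<close> gives a map of the square with
  vertical sides \<open>\<alpha>\<close> and horizontal sides \<open>f \<circ> p\<close>. A square is convex, so its two boundary paths between
  opposite corners are homotopic, and \<open>\<alpha>\<close> commutes with \<open>f \<circ> p\<close>
  (\<open>Gottlieb_imp_conjugate_along\<close>, resting on \<open>square_imp_path_homotopic\<close>).

  \<^emph>\<open>Central elements are Gottlieb.\<close> If \<open>\<alpha>\<close> commutes with the image of \<open>\<pi>\<^sub>1(A)\<close>, then conjugating \<open>\<alpha>\<close> by
  \<open>f \<circ> p\<close>, for a path \<open>p\<close> from \<open>a\<^sub>0\<close> to \<open>a\<close>, yields a class of loops at \<open>f a\<close> that does not depend on \<open>p\<close>: a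
  flat section of the local system \<open>a \<mapsto> \<pi>\<^sub>1(X, f a)\<close>. It remains to choose representatives of these
  classes that vary continuously. Let \<open>h : A \<rightarrow> C\<close> and \<open>k : C \<rightarrow> A\<close> be inverse homotopy equivalences with \<open>C\<close> a
  CW-complex. Representatives at \<open>f (k x)\<close> are chosen continuously in \<open>x \<in> C\<close>, cell by cell
  (\<open>global_section\<close>). Over a vertex any representative will do. Over an edge the representatives at the two
  ends are conjugate along the edge, which is exactly the condition for filling a square
  (\<open>path_homotopic_imp_square\<close>). Over a cell of dimension \<open>n \<ge> 2\<close> a map is prescribed on the boundary of
  \<open>D\<^sup>n \<times> [0,1]\<close>, an \<open>n\<close>-sphere, and it extends since \<open>\<pi>\<^sub>n(X) = 0\<close> (\<open>prism_extension\<close>).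

  The family over \<open>C\<close> is pulled back along \<open>h\<close>, and the loop over \<open>a\<close> is then conjugated by the \<open>f\<close>-image of the
  track of \<open>a\<close> under the homotopy from \<open>k \<circ> h\<close> to the identity (\<open>conjugate_along_imp_Gottlieb\<close>). This
  conjugation moves base points pointwise, so the resulting \<open>F\<close> equals \<open>f\<close> on \<open>A\<close> on the nose, whatever \<open>A\<close>
  looks like near \<open>a\<^sub>0\<close>. Flatness makes the loop over \<open>a\<^sub>0\<close> homotopic to \<open>\<alpha>\<close>.

  Gluing is done throughout by quotient maps: a continuous surjection from a compact space onto a Hausdorff
  space is one, so a map on the square, the prism, a closed cell or the circle may be defined
  on a parametrising compact space.
\<close>

section \<open>Paths up to homotopy\<close>

lemma continuous_map_compose_on:
  assumes "continuous_map (top_of_set T) X c" "continuous_on S h" "h \<in> S \<rightarrow> T"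
  shows "continuous_map (top_of_set S) X (\<lambda>x. c (h x))"
proof -
  have "continuous_map (top_of_set S) (top_of_set T) h"
    using assms by (simp add: continuous_map_in_subtopology)
  from continuous_map_compose[OF this assms(1)] show ?thesis by (simp add: o_def)
qed

lemma continuous_map_if_le_on:
  fixes a b :: "'a::topological_space \<Rightarrow> real"
  assumes "continuous_on S a" "continuous_on S b"
    and "continuous_map (top_of_set {x \<in> S. a x \<le> b x}) X f"
    and "continuous_map (top_of_set {x \<in> S. b x \<le> a x}) X g"
    and "\<And>x. x \<in> S \<Longrightarrow> a x = b x \<Longrightarrow> f x = g x"
  shows "continuous_map (top_of_set S) X (\<lambda>x. if a x \<le> b x then f x else g x)"
proof (rule continuous_map_cases_le)
  have 1: "S \<inter> {x \<in> S. P x} = {x \<in> S. P x}" for P by blast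
  show "continuous_map (subtopology (top_of_set S) {x \<in> topspace (top_of_set S). a x \<le> b x}) X f"
    "continuous_map (subtopology (top_of_set S) {x \<in> topspace (top_of_set S). b x \<le> a x}) X g"
    using assms by (auto simp: subtopology_subtopology 1)
qed (use assms in auto)

lemma pathin_compose_on:
  "pathin X p \<Longrightarrow> continuous_on S h \<Longrightarrow> h \<in> S \<rightarrow> {0..1} \<Longrightarrow> continuous_map (top_of_set S) X (\<lambda>x. p (h x))"
  unfolding pathin_def by (rule continuous_map_compose_on)

definition path_between :: "'b topology \<Rightarrow> 'b \<Rightarrow> 'b \<Rightarrow> (real \<Rightarrow> 'b) \<Rightarrow> bool" where
  "path_between X x y p \<longleftrightarrow> pathin X p \<and> p 0 = x \<and> p 1 = y"

definition path_homotopic :: "'b topology \<Rightarrow> (real \<Rightarrow> 'b) \<Rightarrow> (real \<Rightarrow> 'b) \<Rightarrow> bool" where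
  "path_homotopic X p q \<longleftrightarrow>
     homotopic_with (\<lambda>h. h 0 = p 0 \<and> h 1 = p 1) (top_of_set {0..1}) X p q"

definition path_join :: "(real \<Rightarrow> 'b) \<Rightarrow> (real \<Rightarrow> 'b) \<Rightarrow> real \<Rightarrow> 'b" (infixr "\<Zsemi>" 75) where
  "p \<Zsemi> q = (\<lambda>t. if t \<le> 1/2 then p (2 * t) else q (2 * t - 1))"

definition path_reverse :: "(real \<Rightarrow> 'b) \<Rightarrow> real \<Rightarrow> 'b" where
  "path_reverse p = (\<lambda>t. p (1 - t))"

lemma path_join_ends [simp]: "(p \<Zsemi> q) 0 = p 0" "(p \<Zsemi> q) 1 = q 1"
  by (auto simp: path_join_def)

lemma path_reverse_ends [simp]: "path_reverse p 0 = p 1" "path_reverse p 1 = p 0"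
  by (auto simp: path_reverse_def)

lemma path_reverse_reverse [simp]: "path_reverse (path_reverse p) = p"
  by (auto simp: path_reverse_def)

lemma comp_path_join: "f \<circ> (p \<Zsemi> q) = (f \<circ> p) \<Zsemi> (f \<circ> q)"
  by (auto simp: path_join_def)

lemma comp_path_reverse: "f \<circ> path_reverse p = path_reverse (f \<circ> p)"
  by (auto simp: path_reverse_def)

lemma path_between_join:
  assumes "path_between X x y p" "path_between X y z q"
  shows "path_between X x z (p \<Zsemi> q)"
proof -
  have "continuous_map (top_of_set {0..1}) X (\<lambda>t. if t \<le> 1/2 then p (2 * t) else q (2 * t - 1))"
    using assms
    by (intro continuous_map_if_le_on pathin_compose_on[where p = p] pathin_compose_on[where p = q]
        continuous_intros) (auto simp: path_between_def mult.commute)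
  then show ?thesis using assms by (auto simp: path_between_def pathin_def path_join_def)
qed

lemma path_between_reverse:
  assumes "path_between X x y p"
  shows "path_between X y x (path_reverse p)"
  using assms pathin_compose_on[of X p "{0..1}" "\<lambda>t. 1 - t"] continuous_on_op_minus[of "{0..1::real}" 1]
  unfolding path_between_def path_reverse_def pathin_def[of X "\<lambda>t. p (1 - t)"]
  by auto

lemma path_between_comp:
  assumes "path_between A x y p" "continuous_map A X f"
  shows "path_between X (f x) (f y) (f \<circ> p)"
  using assms by (auto simp: path_between_def pathin_compose)

lemma path_between_const: "x \<in> topspace X \<Longrightarrow> path_between X x x (\<lambda>_. x)"
  by (auto simp: path_between_def pathin_def)

lemma path_between_topspace:
  assumes "path_between X x y p"
  shows "x \<in> topspace X" "y \<in> topspace X"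
  using assms unfolding path_between_def pathin_def continuous_map_def by fastforce+

lemma path_homotopic_ends:
  assumes "path_homotopic X p q"
  shows "q 0 = p 0" "q 1 = p 1"
  using homotopic_with_imp_property[OF assms[unfolded path_homotopic_def]] by auto

lemma path_homotopic_paths:
  assumes "path_homotopic X p q"
  shows "pathin X p" "pathin X q"
  using homotopic_with_imp_continuous_maps[OF assms[unfolded path_homotopic_def]]
  by (auto simp: pathin_def)

lemma path_homotopic_between:
  assumes "path_homotopic X p q" "path_between X x y p"
  shows "path_between X x y q"
  using assms path_homotopic_ends path_homotopic_paths unfolding path_between_def by metis

lemma path_homotopic_refl: "pathin X p \<Longrightarrow> path_homotopic X p p"
  by (simp add: path_homotopic_def pathin_def)

lemma path_homotopic_sym: 
  assumes "path_homotopic X p q" shows "path_homotopic X q p"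
  using assms path_homotopic_ends[OF assms] unfolding path_homotopic_def
  by (simp add: homotopic_with_sym)

lemma path_homotopic_trans [trans]:
  assumes "path_homotopic X p q" "path_homotopic X q r" 
  shows "path_homotopic X p r"
  using assms(2) path_homotopic_ends[OF assms(1)]
    homotopic_with_trans[OF assms(1)[unfolded path_homotopic_def]]
  by (simp add: path_homotopic_def)

lemma path_homotopic_eq: 
  assumes "pathin X p" "\<And>t. t \<in> {0..1} \<Longrightarrow> p t = q t"
  shows "path_homotopic X p q"
  using assms unfolding path_homotopic_def pathin_def
  by (intro homotopic_with_equal) auto

lemma path_homotopic_cong:
  assumes "path_homotopic X p q"
    and "\<And>t. t \<in> {0..1} \<Longrightarrow> p' t = p t" "\<And>t. t \<in> {0..1} \<Longrightarrow> q' t = q t"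
  shows "path_homotopic X p' q'"
proof -
  have "p' 0 = p 0" "p' 1 = p 1" using assms(2) by auto
  then have "homotopic_with (\<lambda>h. h 0 = p' 0 \<and> h 1 = p' 1) (top_of_set {0..1}) X p q"
    using assms(1) by (simp add: path_homotopic_def)
  then show ?thesis
    unfolding path_homotopic_def by (rule homotopic_with_eq) (use assms in auto)
qed

lemma path_homotopicI:
  fixes h :: "real \<times> real \<Rightarrow> 'b"
  assumes "continuous_map (top_of_set ({0..1} \<times> {0..1})) X h"
    and "\<And>t. t \<in> {0..1} \<Longrightarrow> h (0, t) = p t" "\<And>t. t \<in> {0..1} \<Longrightarrow> h (1, t) = q t"
    and "\<And>s. s \<in> {0..1} \<Longrightarrow> h (s, 0) = p 0" "\<And>s. s \<in> {0..1} \<Longrightarrow> h (s, 1) = p 1"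
  shows "path_homotopic X p q"
  unfolding path_homotopic_def
proof (subst homotopic_with, force, intro exI[of _ h] conjI)
  show "continuous_map (prod_topology (top_of_set {0..1}) (top_of_set {0..1})) X h"
    using assms(1) by (simp add: prod_topology_subtopology_eu)
qed (simp_all add: assms)

lemma path_homotopicE:
  assumes "path_homotopic X p q"
  obtains h :: "real \<times> real \<Rightarrow> 'b" where "continuous_map (top_of_set ({0..1} \<times> {0..1})) X h"
    "\<forall>t. h (0, t) = p t \<and> h (1, t) = q t" "\<forall>s\<in>{0..1}. h (s, 0) = p 0 \<and> h (s, 1) = p 1"
  using assms unfolding path_homotopic_def homotopic_with_def prod_topology_subtopology_eu by metis

lemma path_homotopic_join:
  fixes p q :: "real \<Rightarrow> 'b"
  assumes "path_homotopic X p p'" "path_homotopic X q q'" "p 1 = q 0"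
  shows "path_homotopic X (p \<Zsemi> q) (p' \<Zsemi> q')"
proof -
  obtain h :: "real \<times> real \<Rightarrow> 'b" where h: "continuous_map (top_of_set ({0..1} \<times> {0..1})) X h"
    "\<forall>t. h (0, t) = p t \<and> h (1, t) = p' t" "\<forall>s\<in>{0..1}. h (s, 0) = p 0 \<and> h (s, 1) = p 1"
    using assms(1) by (rule path_homotopicE)
  obtain k :: "real \<times> real \<Rightarrow> 'b" where k: "continuous_map (top_of_set ({0..1} \<times> {0..1})) X k"
    "\<forall>t. k (0, t) = q t \<and> k (1, t) = q' t" "\<forall>s\<in>{0..1}. k (s, 0) = q 0 \<and> k (s, 1) = q 1"
    using assms(2) by (rule path_homotopicE)
  show ?thesis
  proof (rule path_homotopicI)
    show "continuous_map (top_of_set ({0..1} \<times> {0..1})) X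
       (\<lambda>z. if snd z \<le> 1/2 then h (fst z, 2 * snd z) else k (fst z, 2 * snd z - 1))"
    proof (rule continuous_map_if_le_on)
      show "continuous_map (top_of_set {z \<in> {0..1} \<times> {0..1}. snd z \<le> 1/2}) X (\<lambda>z. h (fst z, 2 * snd z))"
        by (rule continuous_map_compose_on[OF h(1)]) (auto intro!: continuous_intros)
      show "continuous_map (top_of_set {z \<in> {0..1} \<times> {0..1}. 1/2 \<le> snd z}) X (\<lambda>z. k (fst z, 2 * snd z - 1))"
        by (rule continuous_map_compose_on[OF k(1)]) (auto intro!: continuous_intros)
    qed (auto intro!: continuous_intros simp: h k assms(3) mult.commute)
  qed (auto simp: path_join_def h k)
qed

text \<open>All reparametrisation arguments are instances of this one: in a convex set any two paths with the same ends
  are joined by the straight-line homotopy, and \<open>c\<close> carries that homotopy to \<open>X\<close>. The groupoid laws below use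
  \<open>S = [0,1]\<close> with \<open>c\<close> the composite path itself, the square uses \<open>S = [0,1]\<^sup>2\<close>.\<close>

lemma path_homotopic_convex_reparam:
  fixes S :: "'a::real_normed_vector set"
  assumes "convex S" "continuous_map (top_of_set S) X c"
    and "continuous_on {0..1} \<phi>" "\<phi> \<in> {0..1} \<rightarrow> S" "continuous_on {0..1} \<psi>" "\<psi> \<in> {0..1} \<rightarrow> S"
    and "\<phi> 0 = \<psi> 0" "\<phi> 1 = \<psi> 1"
  shows "path_homotopic X (\<lambda>t. c (\<phi> t)) (\<lambda>t. c (\<psi> t))"
proof (rule path_homotopicI)
  let ?h = "\<lambda>z. (1 - fst z) *\<^sub>R \<phi> (snd z) + fst z *\<^sub>R \<psi> (snd z)"
  have "continuous_on ({0..1} \<times> {0..1}) (\<lambda>z. \<phi> (snd z))" "continuous_on ({0..1} \<times> {0..1}) (\<lambda>z. \<psi> (snd z))"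
    by (auto intro!: continuous_on_compose2[OF assms(3)] continuous_on_compose2[OF assms(5)] continuous_intros)
  then have "continuous_on ({0..1} \<times> {0..1}) ?h" by (intro continuous_intros)
  moreover have "?h \<in> {0..1} \<times> {0..1} \<rightarrow> S"
    using assms(4,6) \<open>convex S\<close> by (fastforce intro!: convexD)
  ultimately show "continuous_map (top_of_set ({0..1} \<times> {0..1})) X (\<lambda>z. c (?h z))"
    by (rule continuous_map_compose_on[OF assms(2)])
qed (auto simp: assms(7,8) algebra_simps simp flip: scaleR_add_left)

lemma path_homotopic_reparam:
  fixes \<phi> \<psi> :: "real \<Rightarrow> real"
  assumes "pathin X c"
    and "continuous_on {0..1} \<phi>" "\<phi> \<in> {0..1} \<rightarrow> {0..1}" "continuous_on {0..1} \<psi>" "\<psi> \<in> {0..1} \<rightarrow> {0..1}"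
    and "\<phi> 0 = \<psi> 0" "\<phi> 1 = \<psi> 1"
    and "\<And>t. t \<in> {0..1} \<Longrightarrow> p t = c (\<phi> t)" "\<And>t. t \<in> {0..1} \<Longrightarrow> q t = c (\<psi> t)"
  shows "path_homotopic X p q"
proof -
  have "path_homotopic X (\<lambda>t. c (\<phi> t)) (\<lambda>t. c (\<psi> t))"
    using assms by (intro path_homotopic_convex_reparam[where S = "{0..1}"]) (auto simp: pathin_def)
  then show ?thesis by (rule path_homotopic_cong) (use assms in auto)
qed

lemma path_homotopic_assoc:
  assumes "path_between X x y p" "path_between X y z q" "path_between X z w r"
  shows "path_homotopic X ((p \<Zsemi> q) \<Zsemi> r) (p \<Zsemi> (q \<Zsemi> r))"
proof (rule path_homotopic_reparam[where c = "p \<Zsemi> (q \<Zsemi> r)" and \<psi> = "\<lambda>t. t"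
      and \<phi> = "\<lambda>t. min (2 * t) (min (t + 1/4) ((t + 1)/2))"])
  show "pathin X (p \<Zsemi> q \<Zsemi> r)"
    using path_between_join[OF assms(1) path_between_join[OF assms(2,3)]] by (simp add: path_between_def)
  show "((p \<Zsemi> q) \<Zsemi> r) t = (p \<Zsemi> q \<Zsemi> r) (min (2 * t) (min (t + 1 / 4) ((t + 1) / 2)))"
    if "t \<in> {0..1}" for t
  proof -
    consider "t \<le> 1/4" | "1/4 < t" "t \<le> 1/2" | "1/2 < t" by linarith
    then show ?thesis using that
      by cases (auto simp: path_join_def min_def algebra_simps add_divide_distrib diff_divide_distrib)
  qed
qed (auto intro!: continuous_intros simp: min_le_iff_disj)

lemma path_homotopic_const_join:
  assumes "path_between X x y p"
  shows "path_homotopic X ((\<lambda>_. x) \<Zsemi> p) p"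
  using assms
  by (intro path_homotopic_reparam[where c = p and \<psi> = "\<lambda>t. t" and \<phi> = "\<lambda>t. max 0 (2 * t - 1)"])
    (auto intro!: continuous_intros simp: path_between_def path_join_def)

lemma path_homotopic_join_const:
  assumes "path_between X x y p"
  shows "path_homotopic X (p \<Zsemi> (\<lambda>_. y)) p"
  using assms
  by (intro path_homotopic_reparam[where c = p and \<psi> = "\<lambda>t. t" and \<phi> = "\<lambda>t. min 1 (2 * t)"])
    (auto intro!: continuous_intros simp: path_between_def path_join_def)

lemma path_homotopic_reverse_join:
  assumes "path_between X x y p"
  shows "path_homotopic X (path_reverse p \<Zsemi> p) (\<lambda>_. y)"
  using assms
  by (intro path_homotopic_reparam[where c = p and \<psi> = "\<lambda>t. 1" and \<phi> = "\<lambda>t. \<bar>1 - 2 * t\<bar>"])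
    (auto intro!: continuous_intros simp: path_between_def path_join_def path_reverse_def)

lemma path_homotopic_reverse_cancel:
  assumes "path_between X x y p" "path_between X y z q"
  shows "path_homotopic X (path_reverse p \<Zsemi> (p \<Zsemi> q)) q"
proof -
  have "path_homotopic X (path_reverse p \<Zsemi> (p \<Zsemi> q)) ((path_reverse p \<Zsemi> p) \<Zsemi> q)"
    by (rule path_homotopic_sym) (rule path_homotopic_assoc[OF path_between_reverse assms]; fact)
  also have "path_homotopic X \<dots> ((\<lambda>_. y) \<Zsemi> q)"
    using assms by (intro path_homotopic_join path_homotopic_reverse_join path_homotopic_refl) 
      (auto simp: path_between_def)
  also have "path_homotopic X \<dots> q" by (rule path_homotopic_const_join[OF assms(2)])
  finally show ?thesis .
qed

lemma path_homotopic_left_cancel: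
  assumes "path_between X x y p" "path_between X y z q" "path_between X y z q'"
    and "path_homotopic X (p \<Zsemi> q) (p \<Zsemi> q')"
  shows "path_homotopic X q q'"
proof -
  have "path_homotopic X q (path_reverse p \<Zsemi> (p \<Zsemi> q))"
    by (rule path_homotopic_sym) (rule path_homotopic_reverse_cancel[OF assms(1,2)])
  also have "path_homotopic X \<dots> (path_reverse p \<Zsemi> (p \<Zsemi> q'))"
    using assms(1,2) path_between_reverse[OF assms(1)]
    by (intro path_homotopic_join[OF path_homotopic_refl assms(4)]) (simp_all add: path_between_def)
  also have "path_homotopic X \<dots> q'" by (rule path_homotopic_reverse_cancel[OF assms(1,3)])
  finally show ?thesis .
qed

section \<open>Squares\<close>

text \<open>Left then top, and bottom then right, are two paths across the convex square with the same ends.\<close>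

lemma square_imp_path_homotopic:
  fixes H :: "real \<times> real \<Rightarrow> 'b"
  assumes H: "continuous_map (top_of_set ({0..1} \<times> {0..1})) X H"
    and "\<And>t. t \<in> {0..1} \<Longrightarrow> H (0, t) = l t" "\<And>t. t \<in> {0..1} \<Longrightarrow> H (1, t) = r t"
    and "\<And>s. s \<in> {0..1} \<Longrightarrow> H (s, 0) = p s" "\<And>s. s \<in> {0..1} \<Longrightarrow> H (s, 1) = q s"
  shows "path_homotopic X (l \<Zsemi> q) (p \<Zsemi> r)"
proof -
  let ?\<phi> = "\<lambda>t::real. (max 0 (2 * t - 1), min 1 (2 * t))"
  let ?\<psi> = "\<lambda>t::real. (min 1 (2 * t), max 0 (2 * t - 1))"
  have "path_homotopic X (\<lambda>t. H (?\<phi> t)) (\<lambda>t. H (?\<psi> t))" (is "path_homotopic X ?p ?q")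
    by (rule path_homotopic_convex_reparam[OF _ H])
      (auto intro!: continuous_intros convex_Times simp: min_le_iff_disj)
  then show ?thesis
  proof (rule path_homotopic_cong)
    fix t :: real assume that: "t \<in> {0..1}"
    consider "t < 1/2" | "t = 1/2" | "t > 1/2" by linarith
    then have "H (?\<phi> t) = (l \<Zsemi> q) t \<and> H (?\<psi> t) = (p \<Zsemi> r) t"
      using that assms(2-5) assms(2)[of 1] assms(5)[of 0] assms(3)[of 0] assms(4)[of 1]
      by cases (simp_all add: path_join_def max_absorb1 max_absorb2 min_absorb1 min_absorb2 mult.commute[of 2])
    then show "(l \<Zsemi> q) t = ?p t" "(p \<Zsemi> r) t = ?q t" by auto
  qed
qed

lemma continuous_on_compact_imp_quotient_map:
  fixes f :: "'a::topological_space \<Rightarrow> 'b::metric_space"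
  assumes "compact S" "continuous_on S f" "f ` S = T"
  shows "quotient_map (top_of_set S) (top_of_set T) f"
proof (rule continuous_imp_quotient_map)
  show "compact_space (top_of_set S)"
    using assms(1) by (simp add: compact_space_subtopology)
  show "Hausdorff_space (top_of_set T)" by (rule Hausdorff_space_subtopology[OF Hausdorff_space_euclidean])
qed (use assms in \<open>auto simp: continuous_map_in_subtopology\<close>)

lemma quotient_map_lift:
  assumes "quotient_map X Y f" "continuous_map X Z h"
    and "\<forall>x\<in>topspace X. \<forall>y\<in>topspace X. f x = f y \<longrightarrow> h x = h y"
  shows "\<exists>g. continuous_map Y Z g \<and> (\<forall>x\<in>topspace X. g (f x) = h x)"
  using quotient_map_lift_exists[OF assms(1,2)] assms(3) by metis

text \<open>A homotopy \<open>K\<close> between \<open>l \<Zsemi> q\<close> and \<open>p \<Zsemi> r\<close> lives on a square two of whose edges are mapped to points. The map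
  \<open>Q\<close> from the square to itself collapses exactly these two edges, sends each of the other two edges to
  two sides of the target square, and interpolates linearly in between; hence \<open>K\<close> descends along \<open>Q\<close>. The
  point of the construction is that the boundary values are attained exactly, with no
  reparametrisation left over.\<close>

lemma path_homotopic_imp_square:
  assumes lq: "path_homotopic X (l \<Zsemi> q) (p \<Zsemi> r)" and "l 1 = q 0" "p 1 = r 0"
  obtains H :: "real \<times> real \<Rightarrow> 'b" where "continuous_map (top_of_set ({0..1} \<times> {0..1})) X H"
    "\<forall>t\<in>{0..1}. H (0, t) = l t \<and> H (1, t) = r t" "\<forall>s\<in>{0..1}. H (s, 0) = p s \<and> H (s, 1) = q s"
proof -
  let ?I = "{0..1::real} \<times> {0..1::real}"
  obtain K :: "real \<times> real \<Rightarrow> 'b" where K: "continuous_map (top_of_set ?I) X K"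
    "\<forall>t. K (0, t) = (l \<Zsemi> q) t \<and> K (1, t) = (p \<Zsemi> r) t" 
    "\<forall>s\<in>{0..1}. K (s, 0) = (l \<Zsemi> q) 0 \<and> K (s, 1) = (l \<Zsemi> q) 1"
    using lq by (rule path_homotopicE)
  \<comment> \<open>\<open>(b \<tau>, a \<tau>)\<close> runs up the left side and along the top, \<open>(a \<tau>, b \<tau>)\<close> along the bottom and up the right side.\<close>
  define a :: "real \<Rightarrow> real" where "a \<tau> = min (2 * \<tau>) 1" for \<tau>
  define b :: "real \<Rightarrow> real" where "b \<tau> = max 0 (2 * \<tau> - 1)" for \<tau>
  define Q where "Q z = ((1 - fst z) * b (snd z) + fst z * a (snd z), (1 - fst z) * a (snd z) + fst z * b (snd z))"
    for z
  have ab: "a \<tau> + b \<tau> = 2 * \<tau>" "a \<tau> - b \<tau> = min (2 * \<tau>) (2 - 2 * \<tau>)" for \<tau>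
    by (auto simp: a_def b_def)
  \<comment> \<open>The sum of the coordinates of \<open>Q z\<close> recovers \<open>\<tau>\<close>; their difference recovers \<open>\<sigma>\<close> unless \<open>\<tau>\<close> is \<open>0\<close> or \<open>1\<close>, where \<open>K\<close> is constant.\<close>
  have Qsum: "fst (Q z) + snd (Q z) = 2 * snd z" 
    and Qdiff: "fst (Q z) - snd (Q z) = (2 * fst z - 1) * min (2 * snd z) (2 - 2 * snd z)" for z
    using ab[of "snd z"] by (simp_all add: Q_def algebra_simps flip: ab(2))
  have Qcont: "continuous_on ?I Q"
    unfolding Q_def a_def b_def by (intro continuous_intros)
  have "Q ` ?I \<subseteq> ?I"
  proof
    fix w assume "w \<in> Q ` ?I"
    then obtain \<sigma> \<tau> where w: "w = Q (\<sigma>, \<tau>)" and st: "\<sigma> \<in> {0..1}" "\<tau> \<in> {0..1}" by auto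
    have "a \<tau> \<in> {0..1}" "b \<tau> \<in> {0..1}" using st by (auto simp: a_def b_def)
    then have "(1 - \<sigma>) * b \<tau> + \<sigma> * a \<tau> \<in> {0..1}" "(1 - \<sigma>) * a \<tau> + \<sigma> * b \<tau> \<in> {0..1}"
      using st convexD_alt[OF convex_real_interval(5), of "a \<tau>" 0 1 "b \<tau>" \<sigma>]
        convexD_alt[OF convex_real_interval(5), of "b \<tau>" 0 1 "a \<tau>" \<sigma>] by auto
    then show "w \<in> ?I" by (simp add: w Q_def)
  qed
  moreover have "w \<in> Q ` ?I" if "w \<in> ?I" for w
  proof -
    obtain s t where "w = (s, t)" by (cases w)
    with that have w: "w = (s, t)" "s \<in> {0..1}" "t \<in> {0..1}" by auto
    define \<tau> where "\<tau> = (s + t) / 2"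
    define d where "d = min (2 * \<tau>) (2 - 2 * \<tau>)"
    define \<sigma> where "\<sigma> = (if d = 0 then 0 else ((s - t) / d + 1) / 2)"
    have d: "\<bar>s - t\<bar> \<le> d" using w unfolding d_def \<tau>_def by (auto simp: abs_if field_simps)
    then have "-1 \<le> (s - t) / d \<and> (s - t) / d \<le> 1" if "d \<noteq> 0" 
      using that by (auto simp: field_simps)
    then have \<sigma>: "\<sigma> \<in> {0..1}" by (auto simp: \<sigma>_def)
    have \<tau>: "\<tau> \<in> {0..1}" using w by (auto simp: \<tau>_def)
    have "2 * \<sigma> - 1 = (s - t) / d" if "d \<noteq> 0" using that by (simp add: \<sigma>_def field_simps)
    then have "(2 * \<sigma> - 1) * d = s - t" using d by (cases "d = 0") simp_all
    then have "fst (Q (\<sigma>, \<tau>)) - snd (Q (\<sigma>, \<tau>)) = s - t" "fst (Q (\<sigma>, \<tau>)) + snd (Q (\<sigma>, \<tau>)) = s + t"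
      unfolding Qsum Qdiff by (simp_all add: d_def \<tau>_def)
    then have "Q (\<sigma>, \<tau>) = (s, t)" by (auto simp: prod_eq_iff)
    then show ?thesis using \<sigma> \<tau> w by (metis SigmaI image_eqI)
  qed
  ultimately have "Q ` ?I = ?I" by blast
  then have "quotient_map (top_of_set ?I) (top_of_set ?I) Q"
    by (intro continuous_on_compact_imp_quotient_map Qcont compact_Times) auto
  moreover have "K z = K w" if "z \<in> ?I" "w \<in> ?I" "Q z = Q w" for z w
  proof -
    have s: "snd z = snd w" using Qsum[of z] Qsum[of w] that by simp
    have f: "(2 * fst z - 1) * min (2 * snd z) (2 - 2 * snd z) = (2 * fst w - 1) * min (2 * snd w) (2 - 2 * snd w)"
      using Qdiff[of z] Qdiff[of w] that by simp
    consider "snd w = 0" | "snd w = 1" | "min (2 * snd w) (2 - 2 * snd w) \<noteq> 0" by linarith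
    then show ?thesis
    proof cases
      case 3
      then have "fst z = fst w" using f s by simp
      then show ?thesis using s by (metis prod_eq_iff)
    qed (use s K(3) that in \<open>cases z, cases w, auto\<close>)+
  qed
  ultimately obtain H where H: "continuous_map (top_of_set ?I) X H" "\<And>z. z \<in> ?I \<Longrightarrow> H (Q z) = K z"
    using quotient_map_lift_exists[OF _ K(1)] by (metis topspace_euclidean_subtopology)
  show thesis
  proof
    show "\<forall>t\<in>{0..1}. H (0, t) = l t \<and> H (1, t) = r t"
    proof
      fix t :: real assume t: "t \<in> {0..1}"
      have "Q (0, t/2) = (0, t)" "Q (1, t/2) = (t, 0)" 
        using t by (auto simp: Q_def a_def b_def)
      moreover have "Q (0, (1 + t)/2) = (t, 1)" "Q (1, (1 + t)/2) = (1, t)" 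
        using t by (auto simp: Q_def a_def b_def add_divide_distrib)
      ultimately show "H (0, t) = l t \<and> H (1, t) = r t"
        using t H(2)[of "(0, t/2)"] H(2)[of "(1, (1+t)/2)"] K(2) assms(2,3) 
        by (auto simp: path_join_def add_divide_distrib)
    qed
    show "\<forall>t\<in>{0..1}. H (t, 0) = p t \<and> H (t, 1) = q t"
    proof
      fix t :: real assume t: "t \<in> {0..1}"
      have "Q (0, t/2) = (0, t)" "Q (1, t/2) = (t, 0)" 
        using t by (auto simp: Q_def a_def b_def)
      moreover have "Q (0, (1 + t)/2) = (t, 1)" "Q (1, (1 + t)/2) = (1, t)" 
        using t by (auto simp: Q_def a_def b_def add_divide_distrib)
      ultimately show "H (t, 0) = p t \<and> H (t, 1) = q t"
        using t H(2)[of "(1, t/2)"] H(2)[of "(0, (1+t)/2)"] K(2) assms(2,3) 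
        by (auto simp: path_join_def add_divide_distrib)
    qed
  qed (rule H(1))
qed

section \<open>Loops conjugate along a path\<close>

lemma path_homotopic_join_left:
  assumes "path_homotopic X p p'" "path_between X x y p" "path_between X y z q"
  shows "path_homotopic X (p \<Zsemi> q) (p' \<Zsemi> q)"
  using assms by (intro path_homotopic_join path_homotopic_refl) (auto simp: path_between_def)

lemma path_homotopic_join_right:
  assumes "path_homotopic X q q'" "path_between X x y p" "path_between X y z q"
  shows "path_homotopic X (p \<Zsemi> q) (p \<Zsemi> q')"
  using assms by (intro path_homotopic_join[OF path_homotopic_refl]) (auto simp: path_between_def)

lemma path_homotopic_cancel_reverse:
  assumes "path_between X x y p" "path_between X z y q"
  shows "path_homotopic X ((p \<Zsemi> path_reverse q) \<Zsemi> q) p"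
proof -
  note q' = path_between_reverse[OF assms(2)]
  have "path_homotopic X ((p \<Zsemi> path_reverse q) \<Zsemi> q) (p \<Zsemi> (path_reverse q \<Zsemi> q))"
    by (rule path_homotopic_assoc[OF assms(1) q' assms(2)])
  also have "path_homotopic X \<dots> (p \<Zsemi> (\<lambda>_. y))"
    by (rule path_homotopic_join_right[OF path_homotopic_reverse_join[OF assms(2)] assms(1) path_between_join[OF q' assms(2)]])
  also have "path_homotopic X \<dots> p" by (rule path_homotopic_join_const[OF assms(1)])
  finally show ?thesis .
qed

text \<open>The loop \<open>l'\<close> at the end of \<open>p\<close> represents the class of \<open>l\<close> transported along \<open>p\<close>, that is, the class of
  \<open>p\<inverse> l p\<close>. Written without inverses, it says that the boundary of a square
  commutes.\<close>

definition conjugate_along :: "'b topology \<Rightarrow> (real \<Rightarrow> 'b) \<Rightarrow> (real \<Rightarrow> 'b) \<Rightarrow> (real \<Rightarrow> 'b) \<Rightarrow> bool" where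
  "conjugate_along X p l l' \<longleftrightarrow> path_homotopic X (l \<Zsemi> p) (p \<Zsemi> l')"

lemma conjugate_along_homotopic:
  assumes "conjugate_along X p l l'" "path_homotopic X p p'"
    and "path_between X x y p" "path_between X x x l" "path_between X y y l'"
  shows "conjugate_along X p' l l'"
proof -
  note p' = path_homotopic_between[OF assms(2,3)]
  have "path_homotopic X (l \<Zsemi> p') (l \<Zsemi> p)"
    by (rule path_homotopic_join_right[OF path_homotopic_sym[OF assms(2)] assms(4) p'])
  also have "path_homotopic X \<dots> (p \<Zsemi> l')" using assms(1) by (simp add: conjugate_along_def)
  also have "path_homotopic X \<dots> (p' \<Zsemi> l')" by (rule path_homotopic_join_left[OF assms(2,3,5)])
  finally show ?thesis by (simp add: conjugate_along_def)
qed

lemma conjugate_along_join: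
  assumes "conjugate_along X p l l'" "conjugate_along X q l' l''"
    and p: "path_between X x y p" and q: "path_between X y z q" and l: "path_between X x x l"
    and l': "path_between X y y l'" and l'': "path_between X z z l''"
  shows "conjugate_along X (p \<Zsemi> q) l l''"
proof -
  have "path_homotopic X (l \<Zsemi> (p \<Zsemi> q)) ((l \<Zsemi> p) \<Zsemi> q)"
    by (rule path_homotopic_sym[OF path_homotopic_assoc[OF l p q]])
  also have "path_homotopic X \<dots> ((p \<Zsemi> l') \<Zsemi> q)"
    using assms(1) path_homotopic_join_left[OF _ path_between_join[OF l p] q] by (simp add: conjugate_along_def)
  also have "path_homotopic X \<dots> (p \<Zsemi> (l' \<Zsemi> q))" by (rule path_homotopic_assoc[OF p l' q])
  also have "path_homotopic X \<dots> (p \<Zsemi> (q \<Zsemi> l''))"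
    using assms(2) path_homotopic_join_right[OF _ p path_between_join[OF l' q]] by (simp add: conjugate_along_def)
  also have "path_homotopic X \<dots> ((p \<Zsemi> q) \<Zsemi> l'')"
    by (rule path_homotopic_sym[OF path_homotopic_assoc[OF p q l'']])
  finally show ?thesis by (simp add: conjugate_along_def)
qed

lemma conjugate_along_reverse:
  assumes "conjugate_along X p l l'"
    and p: "path_between X x y p" and l: "path_between X x x l" and l': "path_between X y y l'"
  shows "conjugate_along X (path_reverse p) l' l"
proof -
  note r = path_between_reverse[OF p]
  have "path_homotopic X (p \<Zsemi> (l' \<Zsemi> path_reverse p)) ((p \<Zsemi> l') \<Zsemi> path_reverse p)"
    by (rule path_homotopic_sym[OF path_homotopic_assoc[OF p l' r]])
  also have "path_homotopic X \<dots> ((l \<Zsemi> p) \<Zsemi> path_reverse p)"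
    using assms(1) path_homotopic_join_left[OF path_homotopic_sym path_between_join[OF p l'] r] by (simp add: conjugate_along_def)
  also have "path_homotopic X \<dots> l"
    using path_homotopic_cancel_reverse[OF l r] by simp
  also have "path_homotopic X \<dots> (p \<Zsemi> (path_reverse p \<Zsemi> l))"
    using path_homotopic_sym[OF path_homotopic_reverse_cancel[OF r l]] by simp
  finally show ?thesis
    unfolding conjugate_along_def
    by (rule path_homotopic_left_cancel[OF p path_between_join[OF l' r] path_between_join[OF r l]])
qed

lemma conjugate_along_exists:
  assumes p: "path_between X x y p" and l: "path_between X x x l"
  shows "conjugate_along X p l (path_reverse p \<Zsemi> (l \<Zsemi> p))"
  using path_homotopic_sym[OF path_homotopic_reverse_cancel[OF path_between_reverse[OF p] path_between_join[OF l p]]]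
  by (simp add: conjugate_along_def)

text \<open>Transport is determined by its path: if \<open>l'\<close> is \<open>l\<close> transported along \<open>p\<close> and \<open>l''\<close> is \<open>l\<close> transported along
  \<open>p \<Zsemi> q\<close>, go back along \<open>p\<close> and forth along \<open>p \<Zsemi> q\<close>.\<close>

lemma conjugate_along_cancel:
  assumes "conjugate_along X p l l'" "conjugate_along X (p \<Zsemi> q) l l''"
    and p: "path_between X x y p" and q: "path_between X y z q" and l: "path_between X x x l"
    and l': "path_between X y y l'" and l'': "path_between X z z l''"
  shows "conjugate_along X q l' l''"
proof -
  note r = path_between_reverse[OF p] and pq = path_between_join[OF p q]
  have "conjugate_along X (path_reverse p \<Zsemi> (p \<Zsemi> q)) l' l''"
    by (rule conjugate_along_join[OF conjugate_along_reverse[OF assms(1) p l l'] assms(2) r pq l' l l''])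
  then show ?thesis
    by (rule conjugate_along_homotopic[OF _ path_homotopic_reverse_cancel[OF p q] path_between_join[OF r pq] l' l''])
qed

section \<open>Spheres, discs and the circle\<close>

abbreviation unit_sphere :: "nat \<Rightarrow> (nat \<Rightarrow> real) set" where
  "unit_sphere n \<equiv> {x. (\<Sum>i\<le>n. (x i)\<^sup>2) = 1 \<and> (\<forall>i>n. x i = 0)}"

abbreviation unit_disc :: "nat \<Rightarrow> (nat \<Rightarrow> real) set" where
  "unit_disc n \<equiv> {x. (\<Sum>i<n. (x i)\<^sup>2) \<le> 1 \<and> (\<forall>i\<ge>n. x i = 0)}"

lemma nsphere_eq_top_of_set:
  "nsphere n = top_of_set (unit_sphere n)"
  by (simp add: nsphere euclidean_product_topology)

lemma disc_eq_top_of_set: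
  "disc n = top_of_set (unit_disc n)"
  by (simp add: disc_def Euclidean_space_def euclidean_product_topology subtopology_subtopology
      Collect_conj_eq Int_commute)

text \<open>Tychonoff, with the degenerate factor \<open>{0}\<close> in every coordinate from \<open>n\<close> on.\<close>

lemma compact_finite_dim_box: "compact {x :: nat \<Rightarrow> real. (\<forall>i<n. \<bar>x i\<bar> \<le> 1) \<and> (\<forall>i\<ge>n. x i = 0)}"
proof -
  have "compactin (product_topology (\<lambda>i. euclidean) UNIV) (PiE UNIV (\<lambda>i. if i < n then {-1..1::real} else {0}))"
    by (auto simp: compactin_PiE)
  then have "compact (PiE UNIV (\<lambda>i. if i < n then {-1..1::real} else {0}))"
    by (simp add: euclidean_product_topology)
  moreover have "PiE UNIV (\<lambda>i. if i < n then {-1..1::real} else {0}) = {x. (\<forall>i<n. \<bar>x i\<bar> \<le> 1) \<and> (\<forall>i\<ge>n. x i = 0)}"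
    by (auto simp: PiE_def Pi_def abs_le_iff not_less split: if_splits)
  ultimately show ?thesis by simp
qed

lemma compact_disc: "compact (unit_disc n)"
proof -
  have "closed {x :: nat \<Rightarrow> real. (\<Sum>i<n. (x i)\<^sup>2) \<le> 1}"
    by (intro closed_Collect_le continuous_intros continuous_on_product_coordinates)
  then have "compact ({x :: nat \<Rightarrow> real. (\<forall>i<n. \<bar>x i\<bar> \<le> 1) \<and> (\<forall>i\<ge>n. x i = 0)} \<inter> {x. (\<Sum>i<n. (x i)\<^sup>2) \<le> 1})"
    by (intro compact_Int_closed compact_finite_dim_box)
  moreover have "\<bar>x i\<bar> \<le> 1" if "(\<Sum>i<n. (x i)\<^sup>2) \<le> 1" "i < n" for x :: "nat \<Rightarrow> real" and i
  proof -
    have "(x i)\<^sup>2 \<le> (\<Sum>i<n. (x i)\<^sup>2)" using that by (intro member_le_sum) auto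
    then have "(x i)\<^sup>2 \<le> 1" using that by linarith
    then show ?thesis by (simp add: abs_square_le_1)
  qed
  then have "{x :: nat \<Rightarrow> real. (\<forall>i<n. \<bar>x i\<bar> \<le> 1) \<and> (\<forall>i\<ge>n. x i = 0)} \<inter> {x. (\<Sum>i<n. (x i)\<^sup>2) \<le> 1}
     = {x :: nat \<Rightarrow> real. (\<Sum>i<n. (x i)\<^sup>2) \<le> 1 \<and> (\<forall>i\<ge>n. x i = 0)}" by blast
  ultimately show ?thesis by simp
qed

lemma compact_sphere: "compact (unit_sphere n)"
proof -
  have "closed {x :: nat \<Rightarrow> real. (\<Sum>i\<le>n. (x i)\<^sup>2) = 1}"
    by (intro closed_Collect_eq continuous_intros continuous_on_product_coordinates)
  then have "compact ({x :: nat \<Rightarrow> real. (\<Sum>i<Suc n. (x i)\<^sup>2) \<le> 1 \<and> (\<forall>i\<ge>Suc n. x i = 0)} \<inter> {x. (\<Sum>i\<le>n. (x i)\<^sup>2) = 1})"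
    by (intro compact_Int_closed compact_disc)
  moreover have "{x :: nat \<Rightarrow> real. (\<Sum>i<Suc n. (x i)\<^sup>2) \<le> 1 \<and> (\<forall>i\<ge>Suc n. x i = 0)} \<inter> {x. (\<Sum>i\<le>n. (x i)\<^sup>2) = 1}
     = {x :: nat \<Rightarrow> real. (\<Sum>i\<le>n. (x i)\<^sup>2) = 1 \<and> (\<forall>i>n. x i = 0)}"
    by (auto simp: lessThan_Suc_atMost Suc_le_eq)
  ultimately show ?thesis by simp
qed

definition circle_point :: "real \<Rightarrow> nat \<Rightarrow> real" where
  "circle_point t = (\<lambda>i. if i = 0 then cos (2 * pi * t) else if i = 1 then sin (2 * pi * t) else 0)"

lemma circle_point_ends [simp]: "circle_point 0 = sphere_base" "circle_point 1 = sphere_base"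
  by (auto simp: circle_point_def sphere_base_def)

lemma continuous_on_circle_point: "continuous_on S circle_point"
proof (rule continuous_on_coordinatewise_then_product)
  show "continuous_on S (\<lambda>t. circle_point t i)" for i
    unfolding circle_point_def by (cases "i = 0"; cases "i = 1") (auto intro!: continuous_intros)
qed

lemma circle_point_in: "circle_point t \<in> topspace (nsphere 1)"
  by (simp add: nsphere_eq_top_of_set circle_point_def)

lemma circle_point_eq:
  assumes "circle_point s = circle_point t" "s \<in> {0..1}" "t \<in> {0..1}"
  shows "s = t \<or> s \<in> {0, 1} \<and> t \<in> {0, 1}"
proof -
  have "cos (2 * pi * s) = cos (2 * pi * t)" "sin (2 * pi * s) = sin (2 * pi * t)"
    using fun_cong[OF assms(1), of 0] fun_cong[OF assms(1), of 1] by (auto simp: circle_point_def)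
  then obtain n :: int where "2 * pi * s = 2 * pi * t + 2 * pi * n"
    using sin_cos_eq_iff by blast
  then have "2 * pi * (s - t) = 2 * pi * n" by (simp add: algebra_simps)
  then have n: "s - t = n" by simp
  have "real_of_int n \<le> 1" "- 1 \<le> real_of_int n" using n assms by auto
  then have "n = 0 \<or> n = 1 \<or> n = -1" by linarith
  then show ?thesis using n assms by auto
qed

lemma circle_point_image: "circle_point ` {0..1} = topspace (nsphere 1)"
proof
  show "topspace (nsphere 1) \<subseteq> circle_point ` {0..1}"
  proof
    fix x assume x: "x \<in> topspace (nsphere 1)"
    then have "(x 0)\<^sup>2 + (x 1)\<^sup>2 = 1" and x2: "\<forall>i>1. x i = 0" by (auto simp: nsphere_eq_top_of_set)
    then obtain \<theta> where \<theta>: "0 \<le> \<theta>" "\<theta> < 2 * pi" "x 0 = cos \<theta>" "x 1 = sin \<theta>"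
      using sincos_total_2pi by metis
    then have "x = circle_point (\<theta> / (2 * pi))" using x2 by (auto simp: circle_point_def fun_eq_iff)
    moreover have "\<theta> / (2 * pi) \<in> {0..1}" using \<theta> by auto
    ultimately show "x \<in> circle_point ` {0..1}" by blast
  qed
qed (use circle_point_in in auto)

lemma quotient_map_circle_point: "quotient_map (top_of_set {0..1}) (nsphere 1) circle_point"
  unfolding nsphere_eq_top_of_set
  by (rule continuous_on_compact_imp_quotient_map)
    (use circle_point_image continuous_on_circle_point in \<open>auto simp: nsphere_eq_top_of_set\<close>)

text \<open>A product of a quotient map with an arbitrary space need not be a quotient map. Here it is: the
  parametrisation of the circle is proper, properness is inherited by products, and a proper continuous
  surjection is closed, hence a quotient map.\<close>

lemma quotient_map_id_times_circle_point:
  "quotient_map (prod_topology A (top_of_set {0..1})) (prod_topology A (nsphere 1)) (\<lambda>(a, t). (a, circle_point t))"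
proof -
  have "proper_map (top_of_set {0..1::real}) (nsphere 1) circle_point"
    unfolding nsphere_eq_top_of_set
  proof (rule continuous_imp_proper_map)
    show "compact_space (top_of_set {0..1::real})" by (simp add: compact_space_subtopology)
    show "kc_space (top_of_set (unit_sphere 1))"
      by (intro Hausdorff_imp_kc_space Hausdorff_space_subtopology Hausdorff_space_euclidean)
    show "continuous_map (top_of_set {0..1}) (top_of_set (unit_sphere 1)) circle_point"
      using quotient_imp_continuous_map[OF quotient_map_circle_point] by (simp add: nsphere_eq_top_of_set)
  qed
  then have "proper_map (prod_topology A (top_of_set {0..1})) (prod_topology A (nsphere 1)) (\<lambda>(a, t). (a, circle_point t))"
    using proper_map_id[of A] by (simp add: proper_map_prod id_def)
  then have "closed_map (prod_topology A (top_of_set {0..1})) (prod_topology A (nsphere 1)) (\<lambda>(a, t). (a, circle_point t))"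
    by (rule proper_imp_closed_map)
  moreover have "continuous_map (prod_topology A (top_of_set {0..1})) (prod_topology A (nsphere 1)) (\<lambda>(a, t). (a, circle_point t))"
    using quotient_imp_continuous_map[OF quotient_map_circle_point] by (simp add: continuous_map_prod_top)
  moreover have "(\<lambda>(a, t). (a, circle_point t)) ` topspace (prod_topology A (top_of_set {0..1})) = topspace (prod_topology A (nsphere 1))"
    using circle_point_image by (fastforce simp: image_iff)
  ultimately show ?thesis by (simp add: continuous_closed_imp_quotient_map)
qed

lemma continuous_map_from_circle:
  "continuous_map (nsphere 1) X \<alpha> \<longleftrightarrow> pathin X (\<alpha> \<circ> circle_point)"
  unfolding pathin_def using continuous_compose_quotient_map_eq[OF quotient_map_circle_point] by metis

lemma based_map_circle_iff:
  "based_map (nsphere 1) sphere_base X x \<alpha> \<longleftrightarrow> path_between X x x (\<alpha> \<circ> circle_point)"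
  by (auto simp: based_map_def path_between_def continuous_map_from_circle simp del: One_nat_def)

text \<open>Translates the homotopies of maps on the circle into homotopies of paths. The direction from paths
  to the circle descends a homotopy along \<open>[0,1] \<times> [0,1] \<rightarrow> [0,1] \<times> S\<^sup>1\<close>.\<close>

lemma based_homotopic_circle_iff:
  assumes "based_map (nsphere 1) sphere_base X x \<alpha>"
  shows "based_homotopic (nsphere 1) sphere_base X x \<alpha> \<beta> \<longleftrightarrow>
     path_homotopic X (\<alpha> \<circ> circle_point) (\<beta> \<circ> circle_point)" (is "?L = ?R")
proof
  assume ?L
  then show ?R
    using assms quotient_imp_continuous_map[OF quotient_map_circle_point]
    unfolding based_homotopic_def path_homotopic_def
    by (elim homotopic_with_compose_continuous_map_right) (auto simp: based_map_def)
next
  assume ?R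
  then obtain h :: "real \<times> real \<Rightarrow> 'a" where h: "continuous_map (top_of_set ({0..1} \<times> {0..1})) X h"
    "\<forall>t. h (0, t) = (\<alpha> \<circ> circle_point) t \<and> h (1, t) = (\<beta> \<circ> circle_point) t"
    "\<forall>s\<in>{0..1}. h (s, 0) = (\<alpha> \<circ> circle_point) 0 \<and> h (s, 1) = (\<alpha> \<circ> circle_point) 1"
    by (rule path_homotopicE)
  have h': "continuous_map (prod_topology (top_of_set {0..1}) (top_of_set {0..1})) X h"
    using h(1) by (simp add: prod_topology_subtopology_eu)
  obtain k where k: "continuous_map (prod_topology (top_of_set {0..1::real}) (nsphere 1)) X k"
    "\<And>z. z \<in> topspace (prod_topology (top_of_set {0..1}) (top_of_set {0..1})) \<Longrightarrow> k (case z of (a, t) \<Rightarrow> (a, circle_point t)) = h z"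
    using quotient_map_lift_exists[OF quotient_map_id_times_circle_point h'] 
  proof -
    have "h z = h w" if "z \<in> topspace (prod_topology (top_of_set {0..1}) (top_of_set {0..1}))"
      "w \<in> topspace (prod_topology (top_of_set {0..1}) (top_of_set {0..1}))"
      "(case z of (a, t) \<Rightarrow> (a, circle_point t)) = (case w of (a, t) \<Rightarrow> (a, circle_point t))" for z w
      using that h(3) circle_point_eq[of "snd z" "snd w"] by (auto split: prod.splits)
    then show thesis
      using quotient_map_lift_exists[OF quotient_map_id_times_circle_point h'] that by metis
  qed
  have 1: "k (s, circle_point t) = h (s, t)" if "s \<in> {0..1}" "t \<in> {0..1}" for s t
    using k(2)[of "(s, t)"] that by simp
  have base: "sphere_base \<in> topspace (nsphere 1)"
    using circle_point_in[of 0] by simp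
  show ?L
    unfolding based_homotopic_def
  proof (subst homotopic_with, simp add: base del: One_nat_def, intro exI[of _ k] conjI ballI)
    show "k (0, x) = \<alpha> x" if "x \<in> topspace (nsphere 1)" for x
      using that 1[of 0] h(2) unfolding circle_point_image[symmetric] by auto
    show "k (1, x) = \<beta> x" if "x \<in> topspace (nsphere 1)" for x
      using that 1[of 1] h(2) unfolding circle_point_image[symmetric] by auto
    show "k (s, sphere_base) = x" if "s \<in> {0..1}" for s
      using 1[of s 0] h(3) that assms by (auto simp: based_map_def)
  qed (rule k(1))
qed

lemma path_between_imp_circle_map:
  assumes "path_between X x x p"
  obtains \<alpha> where "based_map (nsphere 1) sphere_base X x \<alpha>" "\<forall>t\<in>{0..1}. \<alpha> (circle_point t) = p t"
proof -
  have "continuous_map (top_of_set {0..1}) X p" using assms by (simp add: path_between_def pathin_def)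
  moreover have "p s = p t" if "s \<in> {0..1}" "t \<in> {0..1}" "circle_point s = circle_point t" for s t
    using circle_point_eq[OF that(3,1,2)] assms by (auto simp: path_between_def)
  ultimately obtain \<alpha> where "continuous_map (nsphere 1) X \<alpha>" "\<And>t. t \<in> {0..1} \<Longrightarrow> \<alpha> (circle_point t) = p t"
    using quotient_map_lift_exists[OF quotient_map_circle_point] by (metis topspace_euclidean_subtopology)
  moreover then have "\<alpha> sphere_base = x" using assms by (force simp: path_between_def simp flip: circle_point_ends(1))
  ultimately show thesis using that by (auto simp: based_map_def)
qed

lemma circle_double_circle_point: "circle_double (circle_point t) = circle_point (2 * t)"
  using cos_double[of "2 * pi * t"] sin_double[of "2 * pi * t"]
  by (auto simp: circle_double_def circle_point_def fun_eq_iff mult.left_commute[of _ 2])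

lemma circle_point_periodic: "circle_point (t - 1) = circle_point t"
  by (auto simp: circle_point_def fun_eq_iff right_diff_distrib sin_diff cos_diff)

text \<open>The value \<open>t = 1\<close> is exceptional: it parametrises the base point, where the sign convention selects
  \<open>\<alpha>\<close> although path concatenation has arrived at the end of \<open>\<beta>\<close>; equal base values make the two agree.\<close>

lemma loop_concat_circle_point:
  assumes "\<alpha> sphere_base = \<beta> sphere_base" "t \<in> {0..1}"
  shows "loop_concat \<alpha> \<beta> (circle_point t) = ((\<alpha> \<circ> circle_point) \<Zsemi> (\<beta> \<circ> circle_point)) t"
proof -
  consider "t \<le> 1/2" | "1/2 < t" "t < 1" | "t = 1" using assms by force
  then show ?thesis
  proof cases
    case 1
    then have "0 \<le> sin (2 * pi * t)" using assms by (intro sin_ge_zero) auto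
    with 1 show ?thesis
      by (simp add: loop_concat_def path_join_def circle_double_circle_point) (simp add: circle_point_def)
  next
    case 2
    then have "sin (2 * pi * t) < 0" by (intro sin_lt_zero) auto
    with 2 show ?thesis
      by (simp add: loop_concat_def path_join_def circle_double_circle_point circle_point_periodic) 
       (simp add: circle_point_def)
  next
    case 3
    have "sphere_base 1 = 0" "circle_double sphere_base = sphere_base" 
      using circle_double_circle_point[of 0] by (auto simp: sphere_base_def)
    with 3 assms show ?thesis by (simp add: loop_concat_def path_join_def)
  qed
qed

section \<open>The fundamental group\<close>

lemma based_homotopic_imp_based_map:
  assumes "based_homotopic (nsphere n) sphere_base X x \<alpha> \<beta>"
  shows "based_map (nsphere n) sphere_base X x \<alpha>" "based_map (nsphere n) sphere_base X x \<beta>"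
  using homotopic_with_imp_continuous_maps[OF assms[unfolded based_homotopic_def]]
    homotopic_with_imp_property[OF assms[unfolded based_homotopic_def]] by (auto simp: based_map_def)

lemma sphere_class_self: "based_map (nsphere n) sphere_base X x \<alpha> \<Longrightarrow> \<alpha> \<in> sphere_class n X x \<alpha>"
  by (simp add: sphere_class_def based_homotopic_def based_map_def)

lemma sphere_class_eq_iff:
  assumes "based_map (nsphere n) sphere_base X x \<alpha>" "based_map (nsphere n) sphere_base X x \<beta>"
  shows "sphere_class n X x \<alpha> = sphere_class n X x \<beta> \<longleftrightarrow> based_homotopic (nsphere n) sphere_base X x \<alpha> \<beta>"
proof
  assume "sphere_class n X x \<alpha> = sphere_class n X x \<beta>"
  then show "based_homotopic (nsphere n) sphere_base X x \<alpha> \<beta>"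
    using sphere_class_self[OF assms(2)] unfolding sphere_class_def by blast
next
  assume h: "based_homotopic (nsphere n) sphere_base X x \<alpha> \<beta>"
  then show "sphere_class n X x \<alpha> = sphere_class n X x \<beta>"
    unfolding sphere_class_def based_homotopic_def 
    using homotopic_with_trans[OF homotopic_with_symD] homotopic_with_trans by (intro Collect_cong iffI) blast+
qed

lemma loop_class_eq_iff:
  assumes "based_map (nsphere 1) sphere_base X x \<alpha>" "based_map (nsphere 1) sphere_base X x \<beta>"
  shows "sphere_class 1 X x \<alpha> = sphere_class 1 X x \<beta> \<longleftrightarrow> path_homotopic X (\<alpha> \<circ> circle_point) (\<beta> \<circ> circle_point)"
  using sphere_class_eq_iff[OF assms] based_homotopic_circle_iff[OF assms(1)] by simp

lemma loop_concat_based: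
  assumes "based_map (nsphere 1) sphere_base X x \<alpha>" "based_map (nsphere 1) sphere_base X x \<beta>"
  shows "based_map (nsphere 1) sphere_base X x (loop_concat \<alpha> \<beta>)"
    "path_homotopic X (loop_concat \<alpha> \<beta> \<circ> circle_point) ((\<alpha> \<circ> circle_point) \<Zsemi> (\<beta> \<circ> circle_point))"
proof -
  have "path_between X x x ((\<alpha> \<circ> circle_point) \<Zsemi> (\<beta> \<circ> circle_point))"
    using assms path_between_join unfolding based_map_circle_iff by metis
  moreover have "loop_concat \<alpha> \<beta> (circle_point t) = ((\<alpha> \<circ> circle_point) \<Zsemi> (\<beta> \<circ> circle_point)) t" if "t \<in> {0..1}" for t
    using loop_concat_circle_point[OF _ that, of \<alpha> \<beta>] assms by (simp add: based_map_def)
  ultimately show h: "path_homotopic X (loop_concat \<alpha> \<beta> \<circ> circle_point) ((\<alpha> \<circ> circle_point) \<Zsemi> (\<beta> \<circ> circle_point))"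
    by (intro path_homotopic_sym[OF path_homotopic_eq]) (auto simp: path_between_def)
  show "based_map (nsphere 1) sphere_base X x (loop_concat \<alpha> \<beta>)"
    unfolding based_map_circle_iff
    using path_homotopic_between[OF path_homotopic_sym[OF h] \<open>path_between X x x _\<close>] .
qed

lemma carrier_fundamental_group:
  "c \<in> carrier (fundamental_group X x) \<longleftrightarrow> (\<exists>\<alpha>. based_map (nsphere 1) sphere_base X x \<alpha> \<and> c = sphere_class 1 X x \<alpha>)"
  by (auto simp: fundamental_group_def homotopy_classes_def)

text \<open>The product is a union over all pairs of representatives; concatenation respects homotopy, so all
  members of the union coincide.\<close>

lemma fundamental_group_mult:
  assumes "based_map (nsphere 1) sphere_base X x \<alpha>" "based_map (nsphere 1) sphere_base X x \<beta>"
  shows "sphere_class 1 X x \<alpha> \<otimes>\<^bsub>fundamental_group X x\<^esub> sphere_class 1 X x \<beta> = sphere_class 1 X x (loop_concat \<alpha> \<beta>)"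
proof -
  have "sphere_class 1 X x (loop_concat \<alpha>' \<beta>') = sphere_class 1 X x (loop_concat \<alpha> \<beta>)"
    if a: "\<alpha>' \<in> sphere_class 1 X x \<alpha>" and b: "\<beta>' \<in> sphere_class 1 X x \<beta>" for \<alpha>' \<beta>'
  proof -
    have h: "based_homotopic (nsphere 1) sphere_base X x \<alpha> \<alpha>'" using a by (simp add: sphere_class_def)
    have a': "based_map (nsphere 1) sphere_base X x \<alpha>'" by (rule based_homotopic_imp_based_map(2)[OF h])
    have ha: "path_homotopic X (\<alpha> \<circ> circle_point) (\<alpha>' \<circ> circle_point)"
      using h based_homotopic_circle_iff[OF assms(1)] by simp
    have h: "based_homotopic (nsphere 1) sphere_base X x \<beta> \<beta>'" using b by (simp add: sphere_class_def)
    have b': "based_map (nsphere 1) sphere_base X x \<beta>'" by (rule based_homotopic_imp_based_map(2)[OF h])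
    have hb: "path_homotopic X (\<beta> \<circ> circle_point) (\<beta>' \<circ> circle_point)"
      using h based_homotopic_circle_iff[OF assms(2)] by simp
    have "path_homotopic X ((\<alpha> \<circ> circle_point) \<Zsemi> (\<beta> \<circ> circle_point)) ((\<alpha>' \<circ> circle_point) \<Zsemi> (\<beta>' \<circ> circle_point))"
      using assms by (intro path_homotopic_join ha hb) (simp add: based_map_def)
    then have "path_homotopic X (loop_concat \<alpha>' \<beta>' \<circ> circle_point) (loop_concat \<alpha> \<beta> \<circ> circle_point)"
      using loop_concat_based(2)[OF assms] loop_concat_based(2)[OF a' b'] path_homotopic_trans path_homotopic_sym by metis
    then show ?thesis using loop_class_eq_iff loop_concat_based(1) assms a' b' by metis
  qed
  then have "(\<Union>\<alpha>'\<in>sphere_class 1 X x \<alpha>. \<Union>\<beta>'\<in>sphere_class 1 X x \<beta>. sphere_class 1 X x (loop_concat \<alpha>' \<beta>')) =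
      (\<Union>\<alpha>'\<in>sphere_class 1 X x \<alpha>. \<Union>\<beta>'\<in>sphere_class 1 X x \<beta>. sphere_class 1 X x (loop_concat \<alpha> \<beta>))"
    by (intro SUP_cong refl) 
  also have "\<dots> = sphere_class 1 X x (loop_concat \<alpha> \<beta>)"
    using sphere_class_self[OF assms(1)] sphere_class_self[OF assms(2)] by blast
  finally show ?thesis by (simp add: fundamental_group_def)
qed

lemma fundamental_group_commute_iff:
  assumes "based_map (nsphere 1) sphere_base X x \<alpha>" "based_map (nsphere 1) sphere_base X x \<beta>"
  shows "sphere_class 1 X x \<alpha> \<otimes>\<^bsub>fundamental_group X x\<^esub> sphere_class 1 X x \<beta> =
      sphere_class 1 X x \<beta> \<otimes>\<^bsub>fundamental_group X x\<^esub> sphere_class 1 X x \<alpha> \<longleftrightarrow>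
    conjugate_along X (\<beta> \<circ> circle_point) (\<alpha> \<circ> circle_point) (\<alpha> \<circ> circle_point)"
  unfolding conjugate_along_def fundamental_group_mult[OF assms] fundamental_group_mult[OF assms(2,1)]
    loop_class_eq_iff[OF loop_concat_based(1)[OF assms] loop_concat_based(1)[OF assms(2,1)]]
  using loop_concat_based(2)[OF assms] loop_concat_based(2)[OF assms(2,1)]
  by (meson path_homotopic_trans path_homotopic_sym)

lemma based_map_compose:
  assumes "based_map (nsphere n) sphere_base A a \<beta>" "based_map A a X x f"
  shows "based_map (nsphere n) sphere_base X x (f \<circ> \<beta>)"
  using assms by (auto simp: based_map_def intro: continuous_map_compose)

lemma induced_hom_class:
  assumes "based_map (nsphere 1) sphere_base A a \<beta>" "based_map A a X x f"
  shows "induced_hom X x f (sphere_class 1 A a \<beta>) = sphere_class 1 X x (f \<circ> \<beta>)"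
proof -
  have "sphere_class 1 X x (f \<circ> \<beta>') = sphere_class 1 X x (f \<circ> \<beta>)" if "\<beta>' \<in> sphere_class 1 A a \<beta>" for \<beta>'
  proof -
    have h: "based_homotopic (nsphere 1) sphere_base A a \<beta> \<beta>'" using that by (simp add: sphere_class_def)
    then have "based_homotopic (nsphere 1) sphere_base X x (f \<circ> \<beta>) (f \<circ> \<beta>')"
      using assms(2) homotopic_with_compose_continuous_map_left[OF h[unfolded based_homotopic_def], of X f "\<lambda>h. h sphere_base = x"]
      by (simp add: based_map_def based_homotopic_def)
    then show ?thesis
      using sphere_class_eq_iff based_map_compose[OF _ assms(2)] assms(1) based_homotopic_imp_based_map(2)[OF h] by metis
  qed
  then have "induced_hom X x f (sphere_class 1 A a \<beta>) = (\<Union>\<beta>'\<in>sphere_class 1 A a \<beta>. sphere_class 1 X x (f \<circ> \<beta>))"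
    unfolding induced_hom_def by (intro SUP_cong refl)
  also have "\<dots> = sphere_class 1 X x (f \<circ> \<beta>)" using sphere_class_self[OF assms(1)] by blast
  finally show ?thesis .
qed


section \<open>Filling prisms over cells\<close>

lemma homotopic_maps_top_of_set:
  fixes f g :: "'a::topological_space \<Rightarrow> 'b"
  shows "homotopic_with (\<lambda>_. True) (top_of_set S) X f g \<longleftrightarrow>
    (\<exists>h. continuous_map (top_of_set ({0..1::real} \<times> S)) X h \<and> (\<forall>x\<in>S. h (0, x) = f x \<and> h (1, x) = g x))"
  by (subst homotopic_with) (auto simp: prod_topology_subtopology_eu)

lemma sphere_base_in_unit_sphere: "sphere_base \<in> unit_sphere n"
  using in_topspace_nsphere[of n] by (simp add: nsphere_eq_top_of_set sphere_base_def)

lemma unit_sphere_bounds: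
  assumes "x \<in> unit_sphere n" "i \<le> n"
  shows "(x i)\<^sup>2 \<le> 1" "\<bar>x i\<bar> \<le> 1"
proof -
  have "(x i)\<^sup>2 \<le> (\<Sum>i\<le>n. (x i)\<^sup>2)" using assms by (intro member_le_sum) auto
  then show "(x i)\<^sup>2 \<le> 1" using assms by simp
  then show "\<bar>x i\<bar> \<le> 1" by (simp add: abs_square_le_1)
qed

lemma continuous_on_snd_coordinate: "continuous_on S (\<lambda>z :: real \<times> (nat \<Rightarrow> real). snd z i)"
  by (rule continuous_on_product_then_coordinatewise[OF continuous_on_snd[OF continuous_on_id]])

text \<open>Vanishing of based homotopy classes at \<open>x\<^sub>0\<close> kills maps with any base value. The family \<open>w s\<close> of self-maps of
  the sphere starts at the identity and ends with a map that collapses the cap \<open>x 0 \<ge> 1/2\<close> to the base point. After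
  composing \<open>\<sigma>\<close> with the latter, the path \<open>q\<close> to \<open>x\<^sub>0\<close> can be grown along the cap, which moves the base value
  to \<open>x\<^sub>0\<close>.\<close>

lemma sphere_map_nullhomotopic_free:
  assumes \<sigma>: "continuous_map (nsphere n) X \<sigma>"
    and q: "path_between X (\<sigma> sphere_base) x\<^sub>0 q"
    and null: "\<And>\<alpha>. based_map (nsphere n) sphere_base X x\<^sub>0 \<alpha> \<Longrightarrow>
      homotopic_with (\<lambda>_. True) (nsphere n) X \<alpha> (\<lambda>_. x\<^sub>0)"
  shows "homotopic_with (\<lambda>_. True) (nsphere n) X \<sigma> (\<lambda>_. x\<^sub>0)"
proof -
  let ?S = "unit_sphere n"
  \<comment> \<open>The factor \<open>m\<close> shrinks all coordinates but the first, completely on the cap when \<open>s = 1\<close>; dividing by the norm \<open>N\<close> returns to the sphere. Where \<open>x 0 = 0\<close> nothing is shrunk, so \<open>N\<close> never vanishes.\<close>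
  define m where "m s x = 1 - s * max 0 (min 1 (2 * x 0))" for s :: real and x :: "nat \<Rightarrow> real"
  define N where "N s x = sqrt ((x 0)\<^sup>2 + (m s x)\<^sup>2 * (1 - (x 0)\<^sup>2))" for s and x :: "nat \<Rightarrow> real"
  define w where "w z = (\<lambda>i. (if i = 0 then snd z 0 else m (fst z) (snd z) * snd z i) / N (fst z) (snd z))" 
    for z :: "real \<times> (nat \<Rightarrow> real)"
  have Npos: "0 < (x 0)\<^sup>2 + (m s x)\<^sup>2 * (1 - (x 0)\<^sup>2)" if "x \<in> ?S" for s x
  proof (cases "x 0 = 0")
    case True then show ?thesis by (simp add: m_def)
  next
    case False 
    then have "0 < (x 0)\<^sup>2" by simp
    moreover have "0 \<le> (m s x)\<^sup>2 * (1 - (x 0)\<^sup>2)" using unit_sphere_bounds(1)[OF that, of 0] by simp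
    ultimately show ?thesis by linarith
  qed
  then have N0: "N s x \<noteq> 0" if "x \<in> ?S" for s x
    using that[THEN Npos, of s] by (simp add: N_def)
  have w_in: "w (s, x) \<in> ?S" if "x \<in> ?S" for s x
  proof -
    have *: "(\<Sum>i\<le>n. f i) = f 0 + (\<Sum>i\<in>{..n}-{0}. f i)" for f :: "nat \<Rightarrow> real"
      by (rule sum.remove) auto
    have "(\<Sum>i\<le>n. (w (s, x) i)\<^sup>2) = ((x 0)\<^sup>2 + (\<Sum>i\<in>{..n}-{0}. (m s x)\<^sup>2 * (x i)\<^sup>2)) / (N s x)\<^sup>2"
      unfolding * by (simp add: w_def power_divide power_mult_distrib add_divide_distrib sum_divide_distrib)
    also have "(\<Sum>i\<in>{..n}-{0}. (m s x)\<^sup>2 * (x i)\<^sup>2) = (m s x)\<^sup>2 * (1 - (x 0)\<^sup>2)"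
      using that *[of "\<lambda>i. (x i)\<^sup>2"] by (simp flip: sum_distrib_left)
    also have "((x 0)\<^sup>2 + (m s x)\<^sup>2 * (1 - (x 0)\<^sup>2)) / (N s x)\<^sup>2 = 1"
      using Npos[OF that, of s] by (simp add: N_def)
    finally show ?thesis using that by (auto simp: w_def)
  qed
  have w_cont: "continuous_on ({0..1} \<times> ?S) w"
  proof (rule continuous_on_coordinatewise_then_product)
    have "continuous_on ({0..1} \<times> ?S) (\<lambda>z. N (fst z) (snd z))" "continuous_on ({0..1} \<times> ?S) (\<lambda>z. m (fst z) (snd z))"
      unfolding N_def m_def by (intro continuous_intros continuous_on_snd_coordinate)+
    then show "continuous_on ({0..1} \<times> ?S) (\<lambda>z. w z i)" for i
      unfolding w_def using N0 by (cases "i = 0") (auto intro!: continuous_intros continuous_on_snd_coordinate)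
  qed
  have w0: "w (0, x) = x" for x by (auto simp: w_def N_def m_def fun_eq_iff)
  have w1: "w (1, x) = sphere_base" if "x 0 \<ge> 1/2" for x
    using that by (auto simp: w_def N_def m_def fun_eq_iff sphere_base_def)
  have \<sigma>c: "continuous_map (top_of_set ?S) X \<sigma>" using \<sigma> by (simp add: nsphere_eq_top_of_set)
  define \<alpha> where "\<alpha> s x = (if x 0 \<le> 1/2 then \<sigma> (w (1, x)) else q (s * (2 * x 0 - 1)))" for s x
  have h1: "homotopic_with (\<lambda>_. True) (top_of_set ?S) X \<sigma> (\<lambda>x. \<sigma> (w (1, x)))"
    unfolding homotopic_maps_top_of_set
  proof (intro exI[of _ "\<lambda>z. \<sigma> (w z)"] conjI)
    show "continuous_map (top_of_set ({0..1} \<times> ?S)) X (\<lambda>z. \<sigma> (w z))"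
      by (rule continuous_map_compose_on[OF \<sigma>c w_cont]) (use w_in in blast)
  qed (simp add: w0)
  have h2: "homotopic_with (\<lambda>_. True) (top_of_set ?S) X (\<lambda>x. \<sigma> (w (1, x))) (\<alpha> 1)"
    unfolding homotopic_maps_top_of_set
  proof (intro exI conjI)
    have "continuous_on {z \<in> {0..1} \<times> ?S. snd z 0 \<le> 1/2} (\<lambda>z. w (1, snd z))"
      by (rule continuous_on_compose2[OF w_cont]) (intro continuous_intros, auto)
    then have 1: "continuous_map (top_of_set {z \<in> {0..1} \<times> ?S. snd z 0 \<le> 1/2}) X (\<lambda>z. \<sigma> (w (1, snd z)))"
      by (rule continuous_map_compose_on[OF \<sigma>c]) (use w_in in auto)
    have 2: "continuous_map (top_of_set {z \<in> {0..1} \<times> ?S. 1/2 \<le> snd z 0}) X (\<lambda>z. q (fst z * (2 * snd z 0 - 1)))"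
      using q unfolding path_between_def
    proof (intro pathin_compose_on[of X q])
      show "(\<lambda>z. fst z * (2 * snd z 0 - 1)) \<in> {z \<in> {0..1} \<times> ?S. 1 / 2 \<le> snd z 0} \<rightarrow> {0..1}"
        using unit_sphere_bounds(2)[of _ n 0] by (auto simp: abs_le_iff intro!: mult_le_one) 
    qed (auto intro!: continuous_intros continuous_on_snd_coordinate)
    have "continuous_map (top_of_set ({0..1} \<times> ?S)) X (\<lambda>z. if snd z 0 \<le> 1/2 then \<sigma> (w (1, snd z)) else q (fst z * (2 * snd z 0 - 1)))"
      by (rule continuous_map_if_le_on[OF _ _ 1 2])
        (use w1 q in \<open>auto intro!: continuous_intros continuous_on_snd_coordinate simp: path_between_def mult.commute\<close>)
    then show "continuous_map (top_of_set ({0..1} \<times> ?S)) X (\<lambda>z. \<alpha> (fst z) (snd z))"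
      by (simp add: \<alpha>_def)
    show "\<forall>x\<in>?S. \<alpha> (fst (0, x)) (snd (0, x)) = \<sigma> (w (1, x)) \<and> \<alpha> (fst (1, x)) (snd (1, x)) = \<alpha> 1 x"
      using w1 q by (auto simp: \<alpha>_def path_between_def)
  qed
  have h3: "homotopic_with (\<lambda>_. True) (top_of_set ?S) X (\<alpha> 1) (\<lambda>_. x\<^sub>0)"
  proof -
    have "continuous_map (nsphere n) X (\<alpha> 1)"
      using homotopic_with_imp_continuous_maps[OF h2] by (simp add: nsphere_eq_top_of_set)
    moreover have "\<alpha> 1 sphere_base = x\<^sub>0" using q by (simp add: \<alpha>_def sphere_base_def path_between_def)
    ultimately show ?thesis using null[of "\<alpha> 1"] by (simp add: based_map_def nsphere_eq_top_of_set)
  qed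
  from homotopic_with_trans[OF homotopic_with_trans[OF h1 h2] h3]
  show ?thesis by (simp add: nsphere_eq_top_of_set)
qed

definition prism_boundary :: "nat \<Rightarrow> ((nat \<Rightarrow> real) \<times> real) set" where
  "prism_boundary n = {z \<in> unit_disc n \<times> {0..1}. (\<Sum>i<n. (fst z i)\<^sup>2) = 1 \<or> snd z = 0 \<or> snd z = 1}"

text \<open>The boundary of the prism is a sphere seen through the gauge \<open>\<nu>\<close> of the convex body \<open>D\<^sup>n \<times> [-1,1]\<close>, and the
  whole prism is the cone on it: \<open>Q (r, x)\<close> is the point on the ray through \<open>x\<close> at gauge distance \<open>1 - r\<close> from the
  centre. A null-homotopy of the boundary map is constant where \<open>r = 1\<close>, the only place where \<open>Q\<close> identifies
  points, and so it descends to the prism. Coordinate \<open>n\<close> of a vector \<open>v\<close> encodes the height \<open>(1 + v n) / 2\<close>.\<close>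

lemma prism_extension:
  assumes b: "continuous_map (top_of_set (prism_boundary n)) X b"
    and null: "\<And>\<sigma>. continuous_map (nsphere n) X \<sigma> \<Longrightarrow> \<exists>c. homotopic_with (\<lambda>_. True) (nsphere n) X \<sigma> (\<lambda>_. c)"
  obtains \<Psi> where "continuous_map (top_of_set (unit_disc n \<times> {0..1})) X \<Psi>"
    "\<forall>z\<in>prism_boundary n. \<Psi> z = b z"
proof -
  let ?S = "unit_sphere n" and ?P = "unit_disc n \<times> {0..1::real}"
  define \<nu> where "\<nu> v = max (sqrt (\<Sum>i<n. (v i)\<^sup>2)) \<bar>v n\<bar>" for v :: "nat \<Rightarrow> real"
  define nrm where "nrm v = sqrt (\<Sum>i\<le>n. (v i)\<^sup>2)" for v :: "nat \<Rightarrow> real"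
  define proj where "proj v = (\<lambda>i. if i < n then v i else 0, (1 + v n) / 2)" for v :: "nat \<Rightarrow> real"
  define emb where "emb y = (\<lambda>i. if i < n then fst y i else if i = n then 2 * snd y - 1 else 0)"
    for y :: "(nat \<Rightarrow> real) \<times> real"
  define V where "V = {v :: nat \<Rightarrow> real. \<forall>i>n. v i = 0}"
  have emb_V: "emb y \<in> V" for y by (auto simp: emb_def V_def)
  have proj_emb: "proj (emb y) = y" if "y \<in> ?P" for y
    using that by (auto simp: emb_def proj_def prod_eq_iff fun_eq_iff)
  have emb_proj: "emb (proj v) = v" if "v \<in> V" for v
    using that by (auto simp: emb_def proj_def V_def fun_eq_iff add_divide_distrib)
  have \<nu>_scale: "\<nu> (\<lambda>i. c * v i) = \<bar>c\<bar> * \<nu> v" for c v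
    by (simp add: \<nu>_def power_mult_distrib abs_mult real_sqrt_mult max_mult_distrib_left flip: sum_distrib_left)
  have nrm_scale: "nrm (\<lambda>i. c * v i) = \<bar>c\<bar> * nrm v" for c v
    by (simp add: nrm_def power_mult_distrib abs_mult real_sqrt_mult flip: sum_distrib_left)
  have \<nu>_nonneg: "0 \<le> \<nu> v" for v by (auto simp: \<nu>_def le_max_iff_disj)
  have \<nu>_0: "\<nu> v = 0 \<Longrightarrow> v i = 0" if "v \<in> V" for v i
  proof -
    assume "\<nu> v = 0"
    then have "sqrt (\<Sum>i<n. (v i)\<^sup>2) \<le> 0" "\<bar>v n\<bar> \<le> 0" unfolding \<nu>_def by linarith+
    then have "(\<Sum>i<n. (v i)\<^sup>2) = 0" "v n = 0" 
      using sum_nonneg[of "{..<n}" "\<lambda>i. (v i)\<^sup>2"] by auto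
    then show "v i = 0" using that by (cases "i < n"; cases "i = n") (auto simp: V_def sum_nonneg_eq_0_iff)
  qed
  have nrm_S: "nrm x = 1" if "x \<in> ?S" for x using that by (simp add: nrm_def)
  have S_V: "x \<in> V" if "x \<in> ?S" for x using that by (auto simp: V_def)
  have \<nu>_S: "\<nu> x > 0" if "x \<in> ?S" for x
  proof -
    have "\<exists>i. x i \<noteq> 0"
    proof (rule ccontr)
      assume "\<not> ?thesis" then have "nrm x = 0" by (simp add: nrm_def)
      then show False using nrm_S[OF that] by simp
    qed
    then show ?thesis using \<nu>_0[OF S_V[OF that]] \<nu>_nonneg[of x] by force
  qed
  define Q where "Q z = proj (\<lambda>i. (1 - fst z) / \<nu> (snd z) * snd z i)" for z :: "real \<times> (nat \<Rightarrow> real)"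
  have emb_Q: "emb (Q (r, x)) = (\<lambda>i. (1 - r) / \<nu> x * x i)" if "x \<in> ?S" for r x
    using S_V[OF that] unfolding Q_def by (subst emb_proj) (auto simp: V_def)
  have \<nu>_Q: "\<nu> (emb (Q (r, x))) = 1 - r" if "x \<in> ?S" "r \<in> {0..1}" for r x
    unfolding emb_Q[OF that(1)] \<nu>_scale using that \<nu>_S[of x] by simp
  have P_iff: "proj v \<in> ?P \<longleftrightarrow> \<nu> v \<le> 1" for v
    by (auto simp: proj_def \<nu>_def abs_le_iff)
  have boundary_iff: "y \<in> prism_boundary n \<longleftrightarrow> \<nu> (emb y) = 1" if "y \<in> ?P" for y
  proof -
    have "\<nu> (emb y) = max (sqrt (\<Sum>i<n. (fst y i)\<^sup>2)) \<bar>2 * snd y - 1\<bar>" by (simp add: \<nu>_def emb_def)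
    moreover have "sqrt (\<Sum>i<n. (fst y i)\<^sup>2) \<le> 1" "\<bar>2 * snd y - 1\<bar> \<le> 1" using that by (auto simp: abs_le_iff)
    ultimately show ?thesis using that by (auto simp: prism_boundary_def max_def)
  qed
  have Q_cont: "continuous_on ({0..1} \<times> ?S) Q"
    unfolding Q_def proj_def
  proof (intro continuous_on_Pair continuous_on_coordinatewise_then_product)
    have \<nu>c: "continuous_on ({0..1::real} \<times> ?S) (\<lambda>z. \<nu> (snd z))"
      unfolding \<nu>_def by (intro continuous_intros continuous_on_snd_coordinate)
    have c: "continuous_on ({0..1} \<times> ?S) (\<lambda>z. (1 - fst z) / \<nu> (snd z) * snd z i)" for i
      by (intro continuous_intros continuous_on_snd_coordinate \<nu>c) (use \<nu>_S in force)
    show "continuous_on ({0..1} \<times> ?S) (\<lambda>z. if i < n then (1 - fst z) / \<nu> (snd z) * snd z i else 0)" for i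
      using c by (cases "i < n") auto
    show "continuous_on ({0..1} \<times> ?S) (\<lambda>z. (1 + (1 - fst z) / \<nu> (snd z) * snd z n) / 2)"
      by (intro continuous_intros c) auto
  qed
  have Q_in: "Q (r, x) \<in> ?P" if "x \<in> ?S" "r \<in> {0..1}" for r x
  proof -
    have "\<nu> (\<lambda>i. (1 - r) / \<nu> x * x i) = 1 - r" using \<nu>_Q[OF that] emb_Q[OF that(1)] by simp
    then show ?thesis using that unfolding Q_def P_iff by simp
  qed
  have Q_surj: "y \<in> Q ` ({0..1} \<times> ?S)" if y: "y \<in> ?P" for y
  proof (cases "\<nu> (emb y) = 0")
    case True
    then have "emb y = (\<lambda>i. 0)" using \<nu>_0[OF emb_V] by blast
    then have "y = Q (1, sphere_base)" using proj_emb[OF y] by (simp add: Q_def)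
    then show ?thesis by (rule image_eqI) (use sphere_base_in_unit_sphere[of n] in auto)
  next
    case False
    define v where "v = emb y"
    have nv: "\<nu> v > 0" "\<nu> v \<le> 1" using False \<nu>_nonneg[of v] P_iff[of v] y proj_emb[OF y] by (auto simp: v_def)
    have "\<exists>i\<le>n. v i \<noteq> 0" 
    proof (rule ccontr)
      assume "\<not> ?thesis" then have "\<nu> v = 0" by (simp add: \<nu>_def)
      then show False using nv by simp
    qed
    then obtain i where "i \<le> n" "v i \<noteq> 0" by blast
    then have "0 < (\<Sum>i\<le>n. (v i)\<^sup>2)" by (intro sum_pos2[of _ i]) auto
    then have np: "nrm v > 0" by (simp add: nrm_def)
    define x where "x = (\<lambda>i. (1 / nrm v) * v i)"
    have "nrm x = 1" unfolding x_def nrm_scale using np by simp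
    then have xS: "x \<in> ?S" using emb_V[of y] by (auto simp: nrm_def x_def v_def V_def)
    have "\<nu> x = \<nu> v / nrm v" unfolding x_def \<nu>_scale using np by simp
    then have "(\<lambda>i. (1 - (1 - \<nu> v)) / \<nu> x * x i) = v" using np nv by (auto simp: x_def)
    then have "y = Q (1 - \<nu> v, x)" using proj_emb[OF y] by (simp add: Q_def v_def)
    then show ?thesis by (rule image_eqI) (use nv xS in auto)
  qed
  have "Q ` ({0..1} \<times> ?S) = ?P" 
  proof (rule equalityI; rule subsetI)
    show "y \<in> ?P" if "y \<in> Q ` ({0..1} \<times> ?S)" for y using that Q_in by blast
  qed (rule Q_surj)
  then have quot: "quotient_map (top_of_set ({0..1} \<times> ?S)) (top_of_set ?P) Q"
    by (intro continuous_on_compact_imp_quotient_map compact_Times compact_sphere Q_cont) auto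
  have Q0: "Q (0, x) \<in> prism_boundary n" if "x \<in> ?S" for x
    using boundary_iff[OF Q_in[OF that, of 0]] \<nu>_Q[OF that, of 0] by simp
  have "continuous_on ?S (\<lambda>x. Q (0, x))"
    by (rule continuous_on_compose2[OF Q_cont]) (auto intro!: continuous_intros)
  then have "continuous_map (top_of_set ?S) X (\<lambda>x. b (Q (0, x)))"
    by (rule continuous_map_compose_on[OF b]) (use Q0 in blast)
  then obtain c where "homotopic_with (\<lambda>_. True) (top_of_set ?S) X (\<lambda>x. b (Q (0, x))) (\<lambda>_. c)"
    using null unfolding nsphere_eq_top_of_set by blast
  then obtain h :: "real \<times> (nat \<Rightarrow> real) \<Rightarrow> 'a" where h: "continuous_map (top_of_set ({0..1} \<times> ?S)) X h"
    "\<And>x. x \<in> ?S \<Longrightarrow> h (0, x) = b (Q (0, x))" "\<And>x. x \<in> ?S \<Longrightarrow> h (1, x) = c"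
    unfolding homotopic_maps_top_of_set by blast
  have fib: "h (r, x) = h (r', x')" if "r \<in> {0..1}" "x \<in> ?S" "r' \<in> {0..1}" "x' \<in> ?S" "Q (r, x) = Q (r', x')" for r x r' x'
  proof -
    have r: "r = r'" using \<nu>_Q[OF that(2,1)] \<nu>_Q[OF that(4,3)] that(5) by simp
    show ?thesis
    proof (cases "r = 1")
      case True then show ?thesis using h(3) that r by simp
    next
      case False
      have "(\<lambda>i. (1 - r) / \<nu> x * x i) = (\<lambda>i. (1 - r) / \<nu> x' * x' i)" (is "?l = ?r")
        using that(5) emb_Q[OF that(2), of r] emb_Q[OF that(4), of r'] r by simp
      moreover from this have "nrm ?l = nrm ?r" by simp
      then have "\<nu> x = \<nu> x'"
        unfolding nrm_scale using False that nrm_S \<nu>_S[OF that(2)] \<nu>_S[OF that(4)] by (simp add: abs_mult field_simps)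
      ultimately have "x = x'" using False \<nu>_S[OF that(4)] by (auto simp: fun_eq_iff)
      then show ?thesis using r by simp
    qed
  qed
  obtain \<Psi> where \<Psi>: "continuous_map (top_of_set ?P) X \<Psi>" "\<And>z. z \<in> {0..1} \<times> ?S \<Longrightarrow> \<Psi> (Q z) = h z"
  proof -
    have "h z = h w" if "z \<in> {0..1} \<times> ?S" "w \<in> {0..1} \<times> ?S" "Q z = Q w" for z w
      using that fib[of "fst z" "snd z" "fst w" "snd w"] by auto
    then have "\<exists>g. continuous_map (top_of_set ?P) X g \<and> (\<forall>z\<in>{0..1} \<times> ?S. g (Q z) = h z)"
      by (intro quotient_map_lift[OF quot h(1), unfolded topspace_euclidean_subtopology]) blast
    then show thesis using that by blast
  qed
  show thesis
  proof
    show "\<forall>y\<in>prism_boundary n. \<Psi> y = b y"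
    proof
      fix y assume y: "y \<in> prism_boundary n"
      then have yP: "y \<in> ?P" by (simp add: prism_boundary_def)
      then obtain r x where rx: "y = Q (r, x)" "r \<in> {0..1}" "x \<in> ?S" using Q_surj[OF yP] by blast
      then have "r = 0" using boundary_iff[OF yP] y \<nu>_Q[OF rx(3,2)] by simp
      then show "\<Psi> y = b y" using \<Psi>(2)[of "(r, x)"] h(2) rx by simp
    qed
  qed (rule \<Psi>(1))
qed

text \<open>Maps of higher spheres are required to contract freely, with no condition on base points; this is the
  form in which obstructions over cells appear.\<close>

definition aspherical :: "'x topology \<Rightarrow> bool" where
  "aspherical X \<longleftrightarrow> (\<forall>n\<ge>2. \<forall>\<sigma>. continuous_map (nsphere n) X \<sigma> \<longrightarrow>
    (\<exists>c. homotopic_with (\<lambda>_. True) (nsphere n) X \<sigma> (\<lambda>_. c)))"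

section \<open>Cell structures\<close>

lemma prod_disc_interval: "prod_topology (disc n) (top_of_set {0..1::real}) = top_of_set (unit_disc n \<times> {0..1})"
  by (simp add: disc_eq_top_of_set prod_topology_subtopology_eu)

lemma convex_unit_disc:
  assumes "a \<in> unit_disc n" "b \<in> unit_disc n" "s \<in> {0..1}"
  shows "(\<lambda>i. (1 - s) * a i + s * b i) \<in> unit_disc n"
proof -
  have "((1 - s) * a i + s * b i)\<^sup>2 \<le> (1 - s) * (a i)\<^sup>2 + s * (b i)\<^sup>2" for i
    using convex_onD[OF convex_power2, of s "a i" "b i"] assms(3) by (simp add: algebra_simps)
  then have "(\<Sum>i<n. ((1 - s) * a i + s * b i)\<^sup>2) \<le> (\<Sum>i<n. (1 - s) * (a i)\<^sup>2 + s * (b i)\<^sup>2)"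
    by (intro sum_mono)
  also have "\<dots> = (1 - s) * (\<Sum>i<n. (a i)\<^sup>2) + s * (\<Sum>i<n. (b i)\<^sup>2)"
    by (simp add: sum.distrib sum_distrib_left)
  also have "\<dots> \<le> 1" using assms by (intro convex_bound_le) auto
  finally show ?thesis using assms by auto
qed

text \<open>The data hidden behind the existential quantifier in the notion of a CW-complex, named so that they can be
  used in constructions. The open cells themselves serve as indices.\<close>

locale cell_structure =
  fixes C :: "'c topology" and E :: "'c set set" and d :: "'c set \<Rightarrow> nat"
    and \<Phi> :: "'c set \<Rightarrow> (nat \<Rightarrow> real) \<Rightarrow> 'c"
  assumes hausdorff: "Hausdorff_space C"
    and disjoint: "pairwise disjnt E"
    and cover: "\<Union>E = topspace C"
    and char_continuous: "e \<in> E \<Longrightarrow> continuous_map (disc (d e)) C (\<Phi> e)"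
    and char_homeomorphic: "e \<in> E \<Longrightarrow>
      homeomorphic_map (subtopology (disc (d e)) (disc_interior (d e))) (subtopology C e) (\<Phi> e)"
    and closure_finite: "e \<in> E \<Longrightarrow>
      \<exists>F. finite F \<and> F \<subseteq> E \<and> (\<forall>c\<in>F. d c < d e) \<and> \<Phi> e ` disc_boundary (d e) \<subseteq> \<Union>F"
    and weak_topology: "S \<subseteq> topspace C \<Longrightarrow> closedin C S \<longleftrightarrow>
      (\<forall>e\<in>E. closedin (disc (d e)) {x \<in> topspace (disc (d e)). \<Phi> e x \<in> S})"
begin

definition skeleton :: "nat \<Rightarrow> 'c set" where
  "skeleton n = \<Union>{e \<in> E. d e < n}"

lemma char_bij:
  assumes "e \<in> E" shows "bij_betw (\<Phi> e) (disc_interior (d e)) e"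
proof -
  have "e \<subseteq> topspace C" using assms cover by blast
  moreover have "disc_interior (d e) \<subseteq> topspace (disc (d e))" by (auto simp: disc_interior_def)
  ultimately show ?thesis
    using homeomorphic_imp_injective_map[OF char_homeomorphic[OF assms]]
      homeomorphic_imp_surjective_map[OF char_homeomorphic[OF assms]]
    by (simp add: bij_betw_def topspace_subtopology_subset Int_absorb1)
qed

lemma unit_disc_split: "unit_disc n = disc_interior n \<union> disc_boundary n"
  by (auto simp: disc_interior_def disc_boundary_def disc_eq_top_of_set)

lemma char_boundary: 
  assumes "e \<in> E" "z \<in> disc_boundary (d e)" shows "\<Phi> e z \<in> skeleton (d e)"
proof -
  obtain F where "F \<subseteq> E" "\<forall>c\<in>F. d c < d e" "\<Phi> e ` disc_boundary (d e) \<subseteq> \<Union>F"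
    using closure_finite[OF assms(1)] by metis
  moreover have "\<Phi> e z \<in> \<Phi> e ` disc_boundary (d e)" using assms(2) by (rule imageI)
  ultimately obtain c where "c \<in> F" "\<Phi> e z \<in> c" by (metis subsetD UnionE)
  then show ?thesis using \<open>F \<subseteq> E\<close> \<open>\<forall>c\<in>F. d c < d e\<close> unfolding skeleton_def by blast
qed

lemma char_disc_in_topspace:
  assumes "e \<in> E" "z \<in> unit_disc (d e)" shows "\<Phi> e z \<in> topspace C"
  using char_continuous[OF assms(1)] assms(2) by (auto simp: continuous_map_def disc_eq_top_of_set)

lemma skeleton_mono: "m \<le> n \<Longrightarrow> skeleton m \<subseteq> skeleton n"
  by (fastforce simp: skeleton_def)

lemma char_disc_in_skeleton:
  assumes "e \<in> E" "d e < n" "z \<in> unit_disc (d e)" shows "\<Phi> e z \<in> skeleton n"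
proof (cases "z \<in> disc_interior (d e)")
  case True
  then have "\<Phi> e z \<in> e" using char_bij[OF assms(1)] by (auto simp: bij_betw_def)
  then show ?thesis using assms by (auto simp: skeleton_def)
next
  case False
  then have "\<Phi> e z \<in> skeleton (d e)" using assms unit_disc_split char_boundary by blast
  then show ?thesis using skeleton_mono[of "d e" n] assms by auto
qed

text \<open>The closed cells are compact in a Hausdorff space, hence closed, and carry the quotient topology of
  their discs even after multiplying by the interval, so finitely many of them can be pasted.\<close>

lemma continuous_map_finite_cells:
  assumes F: "finite F" "F \<subseteq> E"
    and G: "\<And>c. c \<in> F \<Longrightarrow> continuous_map (top_of_set (unit_disc (d c) \<times> {0..1::real})) X (\<lambda>z. G (\<Phi> c (fst z), snd z))"
  shows "continuous_map (prod_topology (subtopology C (\<Union>c\<in>F. \<Phi> c ` unit_disc (d c))) (top_of_set {0..1})) X G"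
    (is "continuous_map (prod_topology (subtopology C ?U) ?I) X G")
proof (rule pasting_lemma_closed[where I = F and T = "\<lambda>c. (\<Phi> c ` unit_disc (d c)) \<times> {0..1}" and f = "\<lambda>_. G"])
  fix c assume c: "c \<in> F"
  then have cE: "c \<in> E" using F by blast
  let ?K = "\<Phi> c ` unit_disc (d c)"
  have KC: "?K \<subseteq> topspace C" using char_disc_in_topspace[OF cE] by blast
  have "compactin (disc (d c)) (unit_disc (d c))"
    using compact_disc[of "d c"] by (simp add: disc_eq_top_of_set compactin_subtopology)
  then have "compactin C ?K" by (rule image_compactin[OF _ char_continuous[OF cE]])
  then have "closedin C ?K" by (rule compactin_imp_closedin[OF hausdorff])
  moreover have "?K \<subseteq> ?U" using c by blast
  ultimately have "closedin (subtopology C ?U) ?K" using closedin_subset_topspace by blast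
  then show "closedin (prod_topology (subtopology C ?U) ?I) (?K \<times> {0..1})"
    by (simp add: closedin_prod_Times_iff)
  have "continuous_map (disc (d c)) (subtopology C ?K) (\<Phi> c)"
    using char_continuous[OF cE] by (auto simp: continuous_map_in_subtopology disc_eq_top_of_set)
  then have "quotient_map (prod_topology (disc (d c)) ?I) (prod_topology (subtopology C ?K) ?I) (\<lambda>(z, t). (\<Phi> c z, t))"
  proof (intro continuous_imp_quotient_map)
    show "compact_space (prod_topology (disc (d c)) ?I)"
      unfolding prod_disc_interval using compact_Times[OF compact_disc compact_Icc]
      by (intro compact_space_subtopology) simp
    show "Hausdorff_space (prod_topology (subtopology C ?K) ?I)"
      by (simp add: Hausdorff_space_prod_topology Hausdorff_space_subtopology hausdorff)
    show "(\<lambda>(z, t). (\<Phi> c z, t)) ` topspace (prod_topology (disc (d c)) ?I) = topspace (prod_topology (subtopology C ?K) ?I)"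
      using map_prod_surj_on[of "\<Phi> c" "unit_disc (d c)" ?K id "{0..1::real}" "{0..1}"] KC
      by (simp add: map_prod_def disc_eq_top_of_set Int_absorb1)
  qed (simp add: continuous_map_prod_top)
  then have "continuous_map (prod_topology (subtopology C ?K) ?I) X G"
    by (rule continuous_compose_quotient_map) (use G[OF c] in \<open>simp add: prod_disc_interval o_def case_prod_beta\<close>)
  moreover have "subtopology (prod_topology (subtopology C ?U) ?I) (?K \<times> {0..1}) = prod_topology (subtopology C ?K) ?I"
    using \<open>?K \<subseteq> ?U\<close> by (simp add: subtopology_Times subtopology_subtopology Int_absorb1)
  ultimately show "continuous_map (subtopology (prod_topology (subtopology C ?U) ?I) (?K \<times> {0..1})) X G" by simp
qed (use F in auto)

text \<open>The weak topology restated: \<open>C\<close> is a quotient of the disjoint union of its discs.\<close>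

lemma quotient_map_cells: "quotient_map (sum_topology (\<lambda>e. disc (d e)) E) C (\<lambda>(e, z). \<Phi> e z)"
  unfolding quotient_map_closedin
proof (intro conjI allI impI)
  show "(\<lambda>(e, z). \<Phi> e z) ` topspace (sum_topology (\<lambda>e. disc (d e)) E) = topspace C"
  proof
    show "topspace C \<subseteq> (\<lambda>(e, z). \<Phi> e z) ` topspace (sum_topology (\<lambda>e. disc (d e)) E)"
    proof
      fix x assume "x \<in> topspace C"
      then obtain e where e: "e \<in> E" "x \<in> e" using cover by blast
      then obtain z where "z \<in> disc_interior (d e)" "x = \<Phi> e z" using char_bij[OF e(1)] by (auto simp: bij_betw_def)
      then show "x \<in> (\<lambda>(e, z). \<Phi> e z) ` topspace (sum_topology (\<lambda>e. disc (d e)) E)"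
        using e by (auto simp: disc_interior_def intro!: image_eqI[of _ _ "(e, z)"])
    qed
  qed (use char_disc_in_topspace in \<open>auto simp: disc_eq_top_of_set\<close>)
  fix S assume S: "S \<subseteq> topspace C"
  have "{z. (e, z) \<in> {x \<in> topspace (sum_topology (\<lambda>e. disc (d e)) E). (case x of (e, z) \<Rightarrow> \<Phi> e z) \<in> S}}
     = {z \<in> topspace (disc (d e)). \<Phi> e z \<in> S}" if "e \<in> E" for e
    using that by auto
  then show "closedin (sum_topology (\<lambda>e. disc (d e)) E) {x \<in> topspace (sum_topology (\<lambda>e. disc (d e)) E). (case x of (e, z) \<Rightarrow> \<Phi> e z) \<in> S} \<longleftrightarrow> closedin C S"
    unfolding closedin_sum_topology weak_topology[OF S] by (auto simp del: topspace_sum_topology) auto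
qed

text \<open>Multiplying by the compact interval preserves the quotient map from the disjoint union of the discs, so
  continuity of a homotopy on \<open>C\<close> may be tested cell by cell.\<close>

lemma continuous_map_from_cells:
  assumes G: "\<And>e. e \<in> E \<Longrightarrow> continuous_map (top_of_set (unit_disc (d e) \<times> {0..1::real})) X (\<lambda>z. G (\<Phi> e (fst z), snd z))"
  shows "continuous_map (prod_topology C (top_of_set {0..1})) X G"
proof -
  let ?I = "top_of_set {0..1::real}" and ?S = "sum_topology (\<lambda>e. disc (d e)) E"
  let ?h = "\<lambda>((e, z), t). G (\<Phi> e z, t)"
  have "continuous_map (prod_topology ?S ?I) X ?h"
    unfolding continuous_map_def
  proof (intro conjI allI impI)
    have "G (\<Phi> e z, t) \<in> topspace X" if "e \<in> E" "z \<in> unit_disc (d e)" "t \<in> {0..1}" for e z t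
    proof -
      have "(\<lambda>z. G (\<Phi> e (fst z), snd z)) \<in> unit_disc (d e) \<times> {0..1} \<rightarrow> topspace X"
        using G[OF that(1)] by (simp add: continuous_map_def)
      from funcset_mem[OF this, of "(z, t)"] show ?thesis using that by simp
    qed
    then show "?h \<in> topspace (prod_topology ?S ?I) \<rightarrow> topspace X"
      by (auto simp: disc_eq_top_of_set)
    fix U assume U: "openin X U"
    show "openin (prod_topology ?S ?I) {x \<in> topspace (prod_topology ?S ?I). ?h x \<in> U}"
      unfolding openin_prod_topology_alt
    proof (intro allI impI)
      fix x t assume x: "(x, t) \<in> {x \<in> topspace (prod_topology ?S ?I). ?h x \<in> U}"
      then obtain e z where ez: "x = (e, z)" "e \<in> E" "z \<in> topspace (disc (d e))" "t \<in> {0..1}" "G (\<Phi> e z, t) \<in> U"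
        by auto
      have "continuous_map (prod_topology (disc (d e)) ?I) X (\<lambda>z. G (\<Phi> e (fst z), snd z))"
        using G[OF ez(2)] by (simp add: prod_disc_interval)
      define W where "W = {y \<in> topspace (prod_topology (disc (d e)) ?I). G (\<Phi> e (fst y), snd y) \<in> U}"
      have o: "openin (prod_topology (disc (d e)) ?I) W"
        unfolding W_def by (rule openin_continuous_map_preimage[OF \<open>continuous_map _ X _\<close> U])
      have "(z, t) \<in> W" using ez by (simp add: W_def)
      from iffD1[OF openin_prod_topology_alt o, rule_format, OF this]
      obtain A B where AB: "openin (disc (d e)) A" "openin ?I B" "z \<in> A" "t \<in> B" "A \<times> B \<subseteq> W"
        by (elim exE conjE)
      have "openin ?S ({e} \<times> A)"
        unfolding openin_sum_topology
      proof (intro conjI ballI)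
        show "openin (disc (d i)) {z. (i, z) \<in> {e} \<times> A}" for i using AB(1) by (cases "i = e") auto
      qed (use openin_subset[OF AB(1)] ez(2) in auto)
      moreover have "({e} \<times> A) \<times> B \<subseteq> {x \<in> topspace (prod_topology ?S ?I). ?h x \<in> U}"
        using AB(5) ez(2) by (auto simp: W_def)
      ultimately show "\<exists>V W. openin ?S V \<and> openin ?I W \<and> x \<in> V \<and> t \<in> W \<and> V \<times> W \<subseteq> {x \<in> topspace (prod_topology ?S ?I). ?h x \<in> U}"
        using AB ez by blast
    qed
  qed
  moreover have "?h = G \<circ> (\<lambda>(x, t). ((\<lambda>(e, z). \<Phi> e z) x, t))" by auto
  moreover have "quotient_map (prod_topology ?S ?I) (prod_topology C ?I) (\<lambda>(x, t). ((\<lambda>(e, z). \<Phi> e z) x, t))"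
  proof (rule quotient_map_prod_left[OF _ _ quotient_map_cells])
    show "locally_compact_space ?I"
      by (simp add: compact_imp_locally_compact_space compact_space_subtopology)
    show "Hausdorff_space ?I \<or> regular_space ?I" 
      using Hausdorff_space_subtopology[OF Hausdorff_space_euclidean] by blast
  qed
  ultimately show ?thesis using continuous_compose_quotient_map by metis
qed

text \<open>Continuity over the \<open>n\<close>-skeleton is recorded only through the characteristic maps. This is enough to
  attach the next cells and avoids a topology on infinite skeleta.\<close>

definition cellwise_section ::
    "'x topology \<Rightarrow> ('c \<Rightarrow> (real \<Rightarrow> 'x) \<Rightarrow> bool) \<Rightarrow> nat \<Rightarrow> ('c \<times> real \<Rightarrow> 'x) \<Rightarrow> bool" where
  "cellwise_section X L n G \<longleftrightarrow>
    (\<forall>c\<in>E. d c < n \<longrightarrow> continuous_map (top_of_set (unit_disc (d c) \<times> {0..1})) X (\<lambda>z. G (\<Phi> c (fst z), snd z))) \<and>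
    (\<forall>x\<in>skeleton n. L x (\<lambda>t. G (x, t)))"

text \<open>Closure-finiteness puts the boundary of a cell into finitely many closed cells of smaller dimension,
  where the family is continuous by pasting.\<close>

lemma cellwise_section_boundary_continuous:
  assumes "cellwise_section X L (d e) G" "e \<in> E"
  shows "continuous_map (top_of_set (disc_boundary (d e) \<times> {0..1})) X (\<lambda>z. G (\<Phi> e (fst z), snd z))"
proof -
  obtain F where F: "finite F" "F \<subseteq> E" "\<forall>c\<in>F. d c < d e" "\<Phi> e ` disc_boundary (d e) \<subseteq> \<Union>F"
    using closure_finite[OF assms(2)] by metis
  define U where "U = (\<Union>c\<in>F. \<Phi> c ` unit_disc (d c))"
  have "\<Union>F \<subseteq> U"
  proof (rule Union_least)
    fix c assume c: "c \<in> F"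
    then have "\<Phi> c ` disc_interior (d c) = c" using char_bij[of c] F(2) by (auto simp: bij_betw_def)
    then have "c \<subseteq> \<Phi> c ` unit_disc (d c)" using unit_disc_split[of "d c"] by (metis image_mono sup_ge1)
    also have "\<dots> \<subseteq> U" unfolding U_def using c by (rule UN_upper)
    finally show "c \<subseteq> U" .
  qed
  with F(4) have sub: "\<Phi> e ` disc_boundary (d e) \<subseteq> U" by (rule subset_trans)
  have "continuous_map (prod_topology (subtopology C U) (top_of_set {0..1})) X G"
    unfolding U_def using assms(1) F by (intro continuous_map_finite_cells) (auto simp: cellwise_section_def)
  moreover have "continuous_map (prod_topology (top_of_set (disc_boundary (d e))) (top_of_set {0..1::real}))
      (prod_topology (subtopology C U) (top_of_set {0..1})) (\<lambda>(z, t). (\<Phi> e z, t))"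
  proof -
    have "continuous_map (subtopology (disc (d e)) (disc_boundary (d e))) C (\<Phi> e)"
      by (rule continuous_map_from_subtopology[OF char_continuous[OF assms(2)]])
    moreover have "subtopology (disc (d e)) (disc_boundary (d e)) = top_of_set (disc_boundary (d e))"
      using unit_disc_split[of "d e"] by (simp add: disc_eq_top_of_set subtopology_subtopology Int_absorb1)
    ultimately have "continuous_map (top_of_set (disc_boundary (d e))) (subtopology C U) (\<Phi> e)"
      using sub by (auto simp: continuous_map_in_subtopology)
    then show ?thesis unfolding continuous_map_prod_top by simp
  qed
  ultimately have "continuous_map (prod_topology (top_of_set (disc_boundary (d e))) (top_of_set {0..1::real})) X
      (G \<circ> (\<lambda>(z, t). (\<Phi> e z, t)))"
    by (metis continuous_map_compose)
  then show ?thesis by (simp add: prod_topology_subtopology_eu o_def case_prod_beta)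
qed

end

lemma flat_family_on_disc:
  assumes n: "n \<ge> 1" and \<Psi>: "continuous_map (top_of_set (unit_disc n \<times> {0..1})) X \<Psi>"
    and ends: "\<And>z. z \<in> unit_disc n \<Longrightarrow> \<Psi> (z, 0) = h z \<and> \<Psi> (z, 1) = h z"
    and z: "z \<in> unit_disc n" "w \<in> unit_disc n"
  defines "e \<equiv> \<lambda>s i. (1 - s) * z i + s * w i"
  shows "path_homotopic X ((\<lambda>t. \<Psi> (z, t)) \<Zsemi> (\<lambda>s. h (e s))) ((\<lambda>s. h (e s)) \<Zsemi> (\<lambda>t. \<Psi> (w, t)))"
proof -
  have e: "e s \<in> unit_disc n" if "s \<in> {0..1}" for s
    unfolding e_def by (rule convex_unit_disc[OF z that])
  show ?thesis
  proof (rule square_imp_path_homotopic)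
    show "continuous_map (top_of_set ({0..1} \<times> {0..1})) X (\<lambda>y. \<Psi> (e (fst y), snd y))"
    proof (rule continuous_map_compose_on[OF \<Psi>])
      show "continuous_on ({0..1} \<times> {0..1}) (\<lambda>y. (e (fst y), snd y))"
        unfolding e_def by (intro continuous_intros continuous_on_coordinatewise_then_product)
    qed (use e in auto)
  qed (use ends e in \<open>auto simp: e_def\<close>)
qed

section \<open>Sections of the conjugation local system\<close>

text \<open>\<open>L x\<close> is the set of loops that represent the value at \<open>x\<close> of a flat section of the local system
  \<open>x \<mapsto> \<pi>\<^sub>1(X, g x)\<close>. By \<open>L_conjugate\<close> any two representatives over the ends of a path are related by transport
  along it, and by \<open>L_transport\<close> every transport of a representative is a representative.\<close>

locale conjugation_section = cell_structure C E d \<Phi> 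
  for C :: "'c topology" and E d \<Phi> +
  fixes X :: "'x topology" and g :: "'c \<Rightarrow> 'x" and L :: "'c \<Rightarrow> (real \<Rightarrow> 'x) \<Rightarrow> bool"
  assumes g: "continuous_map C X g"
    and asph: "aspherical X"
    and L_loop: "L x l \<Longrightarrow> path_between X (g x) (g x) l"
    and L_exists: "x \<in> topspace C \<Longrightarrow> \<exists>l. L x l"
    and L_conjugate: "path_between C x y e \<Longrightarrow> L x l \<Longrightarrow> L y l' \<Longrightarrow> path_homotopic X (l \<Zsemi> (g \<circ> e)) ((g \<circ> e) \<Zsemi> l')"
    and L_transport: "path_between C x y e \<Longrightarrow> L x l \<Longrightarrow> path_between X (g y) (g y) l' \<Longrightarrow>
       path_homotopic X (l \<Zsemi> (g \<circ> e)) ((g \<circ> e) \<Zsemi> l') \<Longrightarrow> L y l'"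
begin

lemma char_continuous_on: "e \<in> E \<Longrightarrow> continuous_map (top_of_set (unit_disc (d e))) C (\<Phi> e)"
  using char_continuous[of e] by (simp add: disc_eq_top_of_set)

lemma g_char_continuous: "e \<in> E \<Longrightarrow> continuous_map (top_of_set (unit_disc (d e))) X (\<lambda>z. g (\<Phi> e z))"
  using continuous_map_compose[OF char_continuous_on g] by (simp add: o_def)

text \<open>Over a disc of positive dimension a continuous family of loops that represents the section at one point
  represents it everywhere: the segment to another point spans a square.\<close>

lemma section_extends_over_cell:
  assumes e: "e \<in> E" "d e \<ge> 1"
    and \<Psi>: "continuous_map (top_of_set (unit_disc (d e) \<times> {0..1})) X \<Psi>"
    and ends: "\<And>z. z \<in> unit_disc (d e) \<Longrightarrow> \<Psi> (z, 0) = g (\<Phi> e z) \<and> \<Psi> (z, 1) = g (\<Phi> e z)"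
    and z: "z \<in> unit_disc (d e)" "L (\<Phi> e z) (\<lambda>t. \<Psi> (z, t))" and w: "w \<in> unit_disc (d e)"
  shows "L (\<Phi> e w) (\<lambda>t. \<Psi> (w, t))"
proof (rule L_transport[OF _ z(2)])
  let ?p = "\<lambda>s i. (1 - s) * z i + s * w i"
  have "continuous_map (top_of_set {0..1}) C (\<lambda>s. \<Phi> e (?p s))"
  proof (rule continuous_map_compose_on[OF char_continuous_on[OF e(1)]])
    show "continuous_on {0..1} ?p"
      by (intro continuous_on_coordinatewise_then_product continuous_intros)
  qed (use convex_unit_disc[OF z(1) w] in blast)
  then show "path_between C (\<Phi> e z) (\<Phi> e w) (\<lambda>s. \<Phi> e (?p s))"
    by (simp add: path_between_def pathin_def)
  have "continuous_map (top_of_set {0..1}) X (\<lambda>t. \<Psi> (w, t))"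
    by (rule continuous_map_compose_on[OF \<Psi>]) (use w in \<open>auto intro!: continuous_intros\<close>)
  then show "path_between X (g (\<Phi> e w)) (g (\<Phi> e w)) (\<lambda>t. \<Psi> (w, t))"
    using ends[OF w] by (simp add: path_between_def pathin_def)
  show "path_homotopic X ((\<lambda>t. \<Psi> (z, t)) \<Zsemi> (g \<circ> (\<lambda>s. \<Phi> e (?p s)))) ((g \<circ> (\<lambda>s. \<Phi> e (?p s))) \<Zsemi> (\<lambda>t. \<Psi> (w, t)))"
    using flat_family_on_disc[OF e(2) \<Psi> ends z(1) w] by (simp add: o_def)
qed

lemma cell_extension_vertex:
  assumes "e \<in> E" "d e = 0"
  obtains \<Psi> where "continuous_map (top_of_set (unit_disc (d e) \<times> {0..1})) X \<Psi>"
    "\<forall>z\<in>disc_boundary (d e). \<forall>t\<in>{0..1}. \<Psi> (z, t) = G (\<Phi> e z, t)"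
    "\<forall>z\<in>unit_disc (d e). L (\<Phi> e z) (\<lambda>t. \<Psi> (z, t))"
proof -
  have D: "z = (\<lambda>_. 0)" if "z \<in> unit_disc (d e)" for z using that assms by auto
  have "\<Phi> e (\<lambda>_. 0) \<in> topspace C" using char_disc_in_topspace[OF assms(1)] assms(2) by simp
  then obtain l where l: "L (\<Phi> e (\<lambda>_. 0)) l" using L_exists by blast
  show thesis
  proof (rule that[of "\<lambda>z. l (snd z)"])
    show "continuous_map (top_of_set (unit_disc (d e) \<times> {0..1})) X (\<lambda>z. l (snd z))"
      using L_loop[OF l] unfolding path_between_def
      by (intro pathin_compose_on[of X l]) (auto intro!: continuous_intros)
    show "\<forall>z\<in>unit_disc (d e). L (\<Phi> e z) (\<lambda>t. l (snd (z, t)))"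
    proof
      fix z assume "z \<in> unit_disc (d e)" 
      from D[OF this] show "L (\<Phi> e z) (\<lambda>t. l (snd (z, t)))" using l by simp
    qed
  qed (use assms in \<open>auto simp: disc_boundary_def\<close>)
qed

text \<open>The loops given over the two ends of the edge are conjugate along it because both represent the flat section,
  and conjugacy along a path fills a square.\<close>

lemma cell_extension_edge:
  assumes e: "e \<in> E" "d e = 1" and G: "cellwise_section X L (d e) G"
  obtains \<Psi> where "continuous_map (top_of_set (unit_disc (d e) \<times> {0..1})) X \<Psi>"
    "\<forall>z\<in>disc_boundary (d e). \<forall>t\<in>{0..1}. \<Psi> (z, t) = G (\<Phi> e z, t)"
    "\<forall>z\<in>unit_disc (d e). \<Psi> (z, 0) = g (\<Phi> e z) \<and> \<Psi> (z, 1) = g (\<Phi> e z)"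
proof -
  define pt :: "real \<Rightarrow> nat \<Rightarrow> real" where "pt s = (\<lambda>i. if i = 0 then s else 0)" for s
  have pt_eq: "z = pt (z 0)" if "z \<in> unit_disc (d e)" for z 
    using that e by (auto simp: pt_def fun_eq_iff)
  have pt_in: "pt s \<in> unit_disc (d e)" if "\<bar>s\<bar> \<le> 1" for s
    using that e by (auto simp: pt_def abs_square_le_1)
  have bd: "z \<in> disc_boundary (d e) \<longleftrightarrow> z = pt (- 1) \<or> z = pt 1" for z
    using pt_eq[of z] e by (auto simp: disc_boundary_def disc_eq_top_of_set power2_eq_1_iff pt_def)
  let ?q = "\<lambda>s. \<Phi> e (pt (2 * s - 1))"
  have "continuous_map (top_of_set {0..1}) C ?q"
  proof (rule continuous_map_compose_on[OF char_continuous_on[OF e(1)]])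
    have "continuous_on {0..1} (\<lambda>x. pt (2 * x - 1) i)" for i 
      by (cases "i = 0") (auto simp: pt_def intro!: continuous_intros)
    then show "continuous_on {0..1} (\<lambda>x. pt (2 * x - 1))"
      by (rule continuous_on_coordinatewise_then_product)
    show "(\<lambda>x. pt (2 * x - 1)) \<in> {0..1} \<rightarrow> unit_disc (d e)"
    proof
      fix x :: real assume "x \<in> {0..1}"
      then show "pt (2 * x - 1) \<in> unit_disc (d e)" by (intro pt_in) (auto simp: abs_le_iff)
    qed
  qed
  then have q: "path_between C (\<Phi> e (pt (- 1))) (\<Phi> e (pt 1)) ?q"
    by (simp add: path_between_def pathin_def)
  define l where "l s = (\<lambda>t. G (\<Phi> e (pt s), t))" for s
  have L: "L (\<Phi> e (pt (- 1))) (l (- 1))" "L (\<Phi> e (pt 1)) (l 1)"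
    using G char_boundary[OF e(1)] bd by (auto simp: cellwise_section_def l_def)
  from path_homotopic_imp_square[OF L_conjugate[OF q L]]
  obtain H :: "real \<times> real \<Rightarrow> 'x" where H: "continuous_map (top_of_set ({0..1} \<times> {0..1})) X H"
    "\<forall>t\<in>{0..1}. H (0, t) = l (- 1) t \<and> H (1, t) = l 1 t" 
    "\<forall>s\<in>{0..1}. H (s, 0) = (g \<circ> ?q) s \<and> H (s, 1) = (g \<circ> ?q) s"
    using L_loop[OF L(1)] L_loop[OF L(2)] by (auto simp: path_between_def)
  have D0: "(z 0 + 1) / 2 \<in> {0..1}" if "z \<in> unit_disc (d e)" for z
    using that e by (auto simp: abs_square_le_1 abs_le_iff)
  show thesis
  proof (rule that[of "\<lambda>y. H ((fst y 0 + 1) / 2, snd y)"])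
    show "continuous_map (top_of_set (unit_disc (d e) \<times> {0..1})) X (\<lambda>y. H ((fst y 0 + 1) / 2, snd y))"
    proof (rule continuous_map_compose_on[OF H(1)])
      show "continuous_on (unit_disc (d e) \<times> {0..1::real}) (\<lambda>x. ((fst x 0 + 1) / 2, snd x))"
        by (intro continuous_intros continuous_on_product_then_coordinatewise[of _ fst]) auto
    qed (use D0 in auto)
    show "\<forall>z\<in>disc_boundary (d e). \<forall>t\<in>{0..1}. H ((fst (z, t) 0 + 1) / 2, snd (z, t)) = G (\<Phi> e z, t)"
      using H(2) by (auto simp: bd l_def) (auto simp: pt_def)
    show "\<forall>z\<in>unit_disc (d e). H ((fst (z, 0) 0 + 1) / 2, snd (z, 0)) = g (\<Phi> e z) \<and>
       H ((fst (z, 1) 0 + 1) / 2, snd (z, 1)) = g (\<Phi> e z)"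
    proof
      fix z assume z: "z \<in> unit_disc (d e)"
      have "2 * ((z 0 + 1) / 2) - 1 = z 0" by (simp add: field_simps)
      then have "?q ((z 0 + 1) / 2) = \<Phi> e z" using pt_eq[OF z] by simp
      then show "H ((fst (z, 0) 0 + 1) / 2, snd (z, 0)) = g (\<Phi> e z) \<and>
         H ((fst (z, 1) 0 + 1) / 2, snd (z, 1)) = g (\<Phi> e z)"
        using H(3) D0[OF z] by simp
    qed
  qed
qed

text \<open>On the lateral boundary of the prism the family is given, on bottom and top it must be \<open>g\<close>. These
  prescriptions agree on the edges, and the resulting map of a sphere is null-homotopic.\<close>

lemma cell_extension_higher:
  assumes e: "e \<in> E" "d e \<ge> 2" and G: "cellwise_section X L (d e) G"
  obtains \<Psi> where "continuous_map (top_of_set (unit_disc (d e) \<times> {0..1})) X \<Psi>"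
    "\<forall>z\<in>disc_boundary (d e). \<forall>t\<in>{0..1}. \<Psi> (z, t) = G (\<Phi> e z, t)"
    "\<forall>z\<in>unit_disc (d e). \<Psi> (z, 0) = g (\<Phi> e z) \<and> \<Psi> (z, 1) = g (\<Phi> e z)"
proof -
  let ?n = "d e"
  \<comment> \<open>On the prism boundary \<open>a\<close> and \<open>b\<close> are nonnegative with product zero: \<open>a\<close> vanishes on the lateral part, \<open>b\<close> on bottom and top. Hence the sign of \<open>a - b\<close> separates the two closed parts.\<close>
  define a where "a z = 1 - (\<Sum>i<?n. (fst z i)\<^sup>2)" for z :: "(nat \<Rightarrow> real) \<times> real"
  define b where "b z = snd z * (1 - snd z)" for z :: "(nat \<Rightarrow> real) \<times> real"
  define \<beta> where "\<beta> z = (if a z \<le> b z then G (\<Phi> e (fst z), snd z) else g (\<Phi> e (fst z)))" for z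
  have bd: "disc_boundary ?n = {z \<in> unit_disc ?n. (\<Sum>i<?n. (z i)\<^sup>2) = 1}"
    by (auto simp: disc_boundary_def disc_eq_top_of_set)
  have ab: "0 \<le> a z" "0 \<le> b z" "a z = 0 \<or> b z = 0" if "z \<in> prism_boundary ?n" for z
    using that by (auto simp: prism_boundary_def a_def b_def)
  have Gends: "G (\<Phi> e z, 0) = g (\<Phi> e z)" "G (\<Phi> e z, 1) = g (\<Phi> e z)" if "z \<in> disc_boundary ?n" for z
    using G char_boundary[OF e(1) that] L_loop by (fastforce simp: cellwise_section_def path_between_def)+
  have "continuous_map (top_of_set (prism_boundary ?n)) X \<beta>"
    unfolding \<beta>_def
  proof (rule continuous_map_if_le_on)
    have "continuous_on (prism_boundary ?n) (\<lambda>z. fst z i)" for i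
      by (rule continuous_on_product_then_coordinatewise) (intro continuous_intros)
    then show "continuous_on (prism_boundary ?n) a" unfolding a_def by (intro continuous_intros)
    show "continuous_on (prism_boundary ?n) b" unfolding b_def by (intro continuous_intros)
    have "{z \<in> prism_boundary ?n. a z \<le> b z} \<subseteq> disc_boundary ?n \<times> {0..1}"
    proof
      fix z assume "z \<in> {z \<in> prism_boundary ?n. a z \<le> b z}"
      then have z: "z \<in> prism_boundary ?n" "a z = 0" using ab[of z] by auto
      then show "z \<in> disc_boundary ?n \<times> {0..1}" by (auto simp: prism_boundary_def bd a_def)
    qed
    then show "continuous_map (top_of_set {z \<in> prism_boundary ?n. a z \<le> b z}) X (\<lambda>z. G (\<Phi> e (fst z), snd z))"
      using cellwise_section_boundary_continuous[OF G e(1)] continuous_map_from_subtopology_mono by blast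
    show "continuous_map (top_of_set {z \<in> prism_boundary ?n. b z \<le> a z}) X (\<lambda>z. g (\<Phi> e (fst z)))"
      by (rule continuous_map_compose_on[OF g_char_continuous[OF e(1)]])
        (intro continuous_intros, auto simp: prism_boundary_def)
    show "G (\<Phi> e (fst z), snd z) = g (\<Phi> e (fst z))" if "z \<in> prism_boundary ?n" "a z = b z" for z
    proof -
      have "a z = 0" "b z = 0" using ab(3)[OF that(1)] that(2) by auto
      then have "fst z \<in> disc_boundary ?n" "snd z = 0 \<or> snd z = 1"
        using that(1) by (auto simp: prism_boundary_def bd a_def b_def)
      then show ?thesis using Gends by auto
    qed
  qed
  then obtain \<Psi> where \<Psi>: "continuous_map (top_of_set (unit_disc ?n \<times> {0..1})) X \<Psi>"
    "\<forall>z\<in>prism_boundary ?n. \<Psi> z = \<beta> z"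
    by (rule prism_extension) (use asph e(2) in \<open>simp add: aspherical_def\<close>)
  have \<Psi>b: "\<Psi> (z, t) = G (\<Phi> e z, t)" if "z \<in> disc_boundary ?n" "t \<in> {0..1}" for z t
  proof -
    have "(z, t) \<in> prism_boundary ?n" "a (z, t) = 0" using that by (auto simp: prism_boundary_def bd a_def)
    then show ?thesis using \<Psi>(2) ab(2) by (auto simp: \<beta>_def)
  qed
  have \<Psi>g: "\<Psi> (z, t) = g (\<Phi> e z)" if "z \<in> unit_disc ?n" "t = 0 \<or> t = 1" for z t
  proof (cases "z \<in> disc_boundary ?n")
    case True then show ?thesis using \<Psi>b Gends that by auto
  next
    case False
    then have "a (z, t) > 0" "b (z, t) = 0" "(z, t) \<in> prism_boundary ?n"
      using that by (auto simp: a_def b_def bd prism_boundary_def)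
    then show ?thesis using \<Psi>(2) by (auto simp: \<beta>_def)
  qed
  show thesis by (rule that[OF \<Psi>(1)]) (use \<Psi>b \<Psi>g in auto)
qed

lemma cell_extension:
  assumes e: "e \<in> E" and G: "cellwise_section X L (d e) G"
  shows "\<exists>\<Psi>. continuous_map (top_of_set (unit_disc (d e) \<times> {0..1})) X \<Psi> \<and>
    (\<forall>z\<in>disc_boundary (d e). \<forall>t\<in>{0..1}. \<Psi> (z, t) = G (\<Phi> e z, t)) \<and>
    (\<forall>z\<in>unit_disc (d e). L (\<Phi> e z) (\<lambda>t. \<Psi> (z, t)))"
proof (cases "d e = 0")
  case True
  obtain \<Psi> where "continuous_map (top_of_set (unit_disc (d e) \<times> {0..1})) X \<Psi>"
    "\<forall>z\<in>disc_boundary (d e). \<forall>t\<in>{0..1}. \<Psi> (z, t) = G (\<Phi> e z, t)"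
    "\<forall>z\<in>unit_disc (d e). L (\<Phi> e z) (\<lambda>t. \<Psi> (z, t))"
    by (rule cell_extension_vertex[OF e True, of G])
  then show ?thesis by (intro exI[of _ \<Psi>] conjI)
next
  case False
  obtain \<Psi> where \<Psi>: "continuous_map (top_of_set (unit_disc (d e) \<times> {0..1})) X \<Psi>"
    "\<forall>z\<in>disc_boundary (d e). \<forall>t\<in>{0..1}. \<Psi> (z, t) = G (\<Phi> e z, t)"
    "\<forall>z\<in>unit_disc (d e). \<Psi> (z, 0) = g (\<Phi> e z) \<and> \<Psi> (z, 1) = g (\<Phi> e z)"
  proof (cases "d e = 1")
    case True show ?thesis by (rule cell_extension_edge[OF e True G that]) 
  next
    case False
    with \<open>d e \<noteq> 0\<close> have "d e \<ge> 2" by simp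
    show ?thesis by (rule cell_extension_higher[OF e \<open>d e \<ge> 2\<close> G that]) 
  qed
  define b :: "nat \<Rightarrow> real" where "b = sphere_base"
  have b: "b \<in> disc_boundary (d e)" "b \<in> unit_disc (d e)"
    using False sphere_base_in_unit_sphere[of "d e - 1"]
    by (auto simp: b_def disc_boundary_def disc_eq_top_of_set sphere_base_def simp flip: lessThan_Suc_atMost)
  have "L (\<Phi> e b) (\<lambda>t. \<Psi> (b, t))"
  proof -
    have LG: "L (\<Phi> e b) (\<lambda>t. G (\<Phi> e b, t))" 
      using G char_boundary[OF e b(1)] by (simp add: cellwise_section_def)
    have c: "path_between C (\<Phi> e b) (\<Phi> e b) (\<lambda>_. \<Phi> e b)"
      by (rule path_between_const[OF char_disc_in_topspace[OF e b(2)]])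
    have pb: "path_between X (g (\<Phi> e b)) (g (\<Phi> e b)) (\<lambda>t. \<Psi> (b, t))"
    proof -
      have "continuous_map (top_of_set {0..1}) X (\<lambda>t. \<Psi> (b, t))"
        by (rule continuous_map_compose_on[OF \<Psi>(1)]) (use b(2) in \<open>auto intro!: continuous_intros\<close>)
      then show ?thesis using \<Psi>(3) b(2) by (simp add: path_between_def pathin_def)
    qed
    \<comment> \<open>\<open>\<Psi>\<close> and \<open>G\<close> agree over \<open>b\<close> for \<open>t\<close> in the unit interval only; transport along the constant path turns this into membership in \<open>L\<close>.\<close>
    have "path_homotopic X ((\<lambda>t. G (\<Phi> e b, t)) \<Zsemi> (g \<circ> (\<lambda>_. \<Phi> e b))) ((g \<circ> (\<lambda>_. \<Phi> e b)) \<Zsemi> (\<lambda>t. G (\<Phi> e b, t)))"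
      by (rule L_conjugate[OF c LG LG])
    then have "path_homotopic X ((\<lambda>t. G (\<Phi> e b, t)) \<Zsemi> (g \<circ> (\<lambda>_. \<Phi> e b))) ((g \<circ> (\<lambda>_. \<Phi> e b)) \<Zsemi> (\<lambda>t. \<Psi> (b, t)))"
      by (rule path_homotopic_cong) (use \<Psi>(2) b(1) in \<open>auto simp: path_join_def\<close>)
    then show ?thesis by (rule L_transport[OF c LG pb])
  qed
  then have "L (\<Phi> e w) (\<lambda>t. \<Psi> (w, t))" if "w \<in> unit_disc (d e)" for w
    using False by (rule_tac section_extends_over_cell[OF e _ \<Psi>(1) \<Psi>(3)[rule_format] b(2) _ that]) auto
  then have "\<forall>w\<in>unit_disc (d e). L (\<Phi> e w) (\<lambda>t. \<Psi> (w, t))" by blast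
  with \<Psi>(1,2) show ?thesis by (intro exI[of _ \<Psi>] conjI)
qed

lemma cell_unique: "e \<in> E \<Longrightarrow> e' \<in> E \<Longrightarrow> x \<in> e \<Longrightarrow> x \<in> e' \<Longrightarrow> e = e'"
  using disjoint unfolding pairwise_def disjnt_def by blast

text \<open>Distinct cells of dimension \<open>n\<close> have disjoint interiors, so the extensions over them can be chosen
  independently; points of the old skeleton keep their loops.\<close>

lemma skeleton_extension:
  assumes G: "cellwise_section X L n G"
  shows "\<exists>G'. cellwise_section X L (Suc n) G' \<and> (\<forall>x\<in>skeleton n. \<forall>t. G' (x, t) = G (x, t))"
proof -
  define extends where "extends e \<Psi> \<longleftrightarrow> continuous_map (top_of_set (unit_disc (d e) \<times> {0..1})) X \<Psi> \<and>
    (\<forall>z\<in>disc_boundary (d e). \<forall>t\<in>{0..1}. \<Psi> (z, t) = G (\<Phi> e z, t)) \<and>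
    (\<forall>z\<in>unit_disc (d e). L (\<Phi> e z) (\<lambda>t. \<Psi> (z, t)))" for e \<Psi>
  have "\<forall>e\<in>{e \<in> E. d e = n}. \<exists>\<Psi>. extends e \<Psi>"
  proof
    fix e assume "e \<in> {e \<in> E. d e = n}"
    then have e: "e \<in> E" "cellwise_section X L (d e) G" using G by auto
    show "\<exists>\<Psi>. extends e \<Psi>" unfolding extends_def by (rule cell_extension[OF e])
  qed
  from bchoice[OF this] obtain \<Psi> where "\<And>e. e \<in> E \<Longrightarrow> d e = n \<Longrightarrow> extends e (\<Psi> e)" by blast
  then have \<Psi>:
    "\<And>e. e \<in> E \<Longrightarrow> d e = n \<Longrightarrow> continuous_map (top_of_set (unit_disc (d e) \<times> {0..1})) X (\<Psi> e)"
    "\<And>e z t. e \<in> E \<Longrightarrow> d e = n \<Longrightarrow> z \<in> disc_boundary (d e) \<Longrightarrow> t \<in> {0..1} \<Longrightarrow> \<Psi> e (z, t) = G (\<Phi> e z, t)"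
    "\<And>e z. e \<in> E \<Longrightarrow> d e = n \<Longrightarrow> z \<in> unit_disc (d e) \<Longrightarrow> L (\<Phi> e z) (\<lambda>t. \<Psi> e (z, t))"
    unfolding extends_def by blast+
  define cell where "cell x = (THE e. e \<in> E \<and> x \<in> e)" for x
  have cell: "cell x = e" if "e \<in> E" "x \<in> e" for e x
    unfolding cell_def using that cell_unique by (intro the_equality) auto
  define G' where "G' y = (if fst y \<in> skeleton n then G y
     else \<Psi> (cell (fst y)) (inv_into (disc_interior n) (\<Phi> (cell (fst y))) (fst y), snd y))" for y
  have old: "G' (x, t) = G (x, t)" if "x \<in> skeleton n" for x t
    using that by (simp add: G'_def)
  have interior: "G' (\<Phi> e z, t) = \<Psi> e (z, t)" "\<Phi> e z \<in> e" if "e \<in> E" "d e = n" "z \<in> disc_interior n" for e z t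
  proof -
    have b: "bij_betw (\<Phi> e) (disc_interior n) e" using char_bij[OF that(1)] that(2) by simp
    then show ze: "\<Phi> e z \<in> e" using that by (auto simp: bij_betw_def)
    have "\<Phi> e z \<notin> skeleton n"
    proof
      assume "\<Phi> e z \<in> skeleton n"
      then obtain c where "c \<in> E" "d c < n" "\<Phi> e z \<in> c" unfolding skeleton_def by blast
      then show False using cell_unique[of c e "\<Phi> e z"] ze that by auto
    qed
    then show "G' (\<Phi> e z, t) = \<Psi> e (z, t)"
      using cell[OF that(1) ze] b that by (simp add: G'_def bij_betw_inv_into_left)
  qed
  have new: "G' (\<Phi> e z, t) = \<Psi> e (z, t)" if "e \<in> E" "d e = n" "z \<in> unit_disc n" "t \<in> {0..1}" for e z t
  proof (cases "z \<in> disc_interior n")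
    case True then show ?thesis using interior that by simp
  next
    case False
    then have "z \<in> disc_boundary (d e)" using that unit_disc_split[of n] by auto
    then show ?thesis using old char_boundary[of e z] \<Psi>(2)[of e z t] that by simp
  qed
  have "cellwise_section X L (Suc n) G'"
    unfolding cellwise_section_def
  proof (intro conjI ballI impI)
    fix c assume c: "c \<in> E" "d c < Suc n"
    show "continuous_map (top_of_set (unit_disc (d c) \<times> {0..1})) X (\<lambda>z. G' (\<Phi> c (fst z), snd z))"
    proof (cases "d c = n")
      case True
      show ?thesis
        by (rule continuous_map_eq[OF \<Psi>(1)[OF c(1) True]]) (use new[OF c(1) True] True in auto)
    next
      case False
      then have dc: "d c < n" using c by simp
      then have "continuous_map (top_of_set (unit_disc (d c) \<times> {0..1})) X (\<lambda>z. G (\<Phi> c (fst z), snd z))"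
        using G c unfolding cellwise_section_def by blast
      then show ?thesis
        by (rule continuous_map_eq) (use old char_disc_in_skeleton[OF c(1) dc] in auto)
    qed
  next
    fix x assume x: "x \<in> skeleton (Suc n)"
    show "L x (\<lambda>t. G' (x, t))"
    proof (cases "x \<in> skeleton n")
      case True then show ?thesis using old G by (simp add: cellwise_section_def)
    next
      case False
      then obtain e where e: "e \<in> E" "d e = n" "x \<in> e" using x unfolding skeleton_def by (auto simp: less_Suc_eq)
      then obtain z where z: "z \<in> disc_interior n" "x = \<Phi> e z" using char_bij[OF e(1)] by (auto simp: bij_betw_def)
      then have "z \<in> unit_disc (d e)" using unit_disc_split[of n] e(2) by auto
      then show ?thesis using \<Psi>(3)[OF e(1,2)] interior(1)[OF e(1,2) z(1)] z(2) by simp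
    qed
  qed
  then show ?thesis using old by blast
qed

lemma global_section:
  "\<exists>G. continuous_map (prod_topology C (top_of_set {0..1})) X G \<and> (\<forall>x\<in>topspace C. L x (\<lambda>t. G (x, t)))"
proof -
  have "\<exists>G. cellwise_section X L 0 G" by (simp add: cellwise_section_def skeleton_def)
  from dependent_nat_choice[of "cellwise_section X L" "\<lambda>n G G'. \<forall>x\<in>skeleton n. \<forall>t. G' (x, t) = G (x, t)", OF this skeleton_extension]
  obtain F where F: "\<And>n. cellwise_section X L n (F n)"
    "\<And>n x t. x \<in> skeleton n \<Longrightarrow> F (Suc n) (x, t) = F n (x, t)" by blast
  have stable: "F n (x, t) = F m (x, t)" if "x \<in> skeleton m" "m \<le> n" for x t m n
    using that(2)
  proof (induction n rule: dec_induct)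
    case (step k)
    then show ?case using F(2)[of x k t] skeleton_mono[of m k] that(1) by auto
  qed simp
  \<comment> \<open>The families over the skeleta are eventually constant at each point, from the first skeleton that contains it.\<close>
  define r where "r x = (LEAST n. x \<in> skeleton n)" for x
  have r: "x \<in> skeleton (r x)" "r x \<le> n" if "x \<in> skeleton n" for x n
    unfolding r_def using that by (auto intro: LeastI Least_le)
  define G where "G y = F (r (fst y)) y" for y
  have G: "G (x, t) = F n (x, t)" if "x \<in> skeleton n" for x t n
    using stable[OF r[OF that]] by (simp add: G_def)
  have "continuous_map (prod_topology C (top_of_set {0..1})) X G"
  proof (rule continuous_map_from_cells)
    fix e assume e: "e \<in> E"
    have "continuous_map (top_of_set (unit_disc (d e) \<times> {0..1})) X (\<lambda>z. F (Suc (d e)) (\<Phi> e (fst z), snd z))"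
      using F(1)[of "Suc (d e)"] e unfolding cellwise_section_def by blast
    then show "continuous_map (top_of_set (unit_disc (d e) \<times> {0..1})) X (\<lambda>z. G (\<Phi> e (fst z), snd z))"
      by (rule continuous_map_eq) (use G[of _ "Suc (d e)"] char_disc_in_skeleton[OF e, of "Suc (d e)"] in auto)
  qed
  moreover have "L x (\<lambda>t. G (x, t))" if x: "x \<in> topspace C" for x
  proof -
    obtain e where "e \<in> E" "x \<in> e" using x cover by blast
    then have "x \<in> skeleton (Suc (d e))" unfolding skeleton_def by blast
    then show ?thesis using F(1)[of "Suc (d e)"] G by (simp add: cellwise_section_def)
  qed
  ultimately show ?thesis by blast
qed

end

section \<open>Gottlieb elements and central loops\<close>

lemma path_join_family:
  assumes P: "continuous_map (prod_topology A (top_of_set {0..1})) X (\<lambda>z. P (fst z) (snd z))"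
    and Q: "continuous_map (prod_topology A (top_of_set {0..1})) X (\<lambda>z. Q (fst z) (snd z))"
    and "\<And>a. a \<in> topspace A \<Longrightarrow> P a 1 = Q a (0::real)"
  shows "continuous_map (prod_topology A (top_of_set {0..1})) X (\<lambda>z. (P (fst z) \<Zsemi> Q (fst z)) (snd z))"
  unfolding path_join_def
proof (rule continuous_map_cases_le)
  let ?Y = "prod_topology A (top_of_set {0..1::real})"
  have snd: "continuous_map ?Y euclideanreal snd"
    using continuous_map_snd continuous_map_in_subtopology by blast
  then show "continuous_map ?Y euclideanreal snd" .
  have reparam: "continuous_map (subtopology ?Y S) ?Y (\<lambda>z. (fst z, h (snd z)))"
    if "continuous_map (subtopology ?Y S) euclideanreal (\<lambda>z. h (snd z))"
      "\<And>z. z \<in> topspace ?Y \<Longrightarrow> z \<in> S \<Longrightarrow> h (snd z) \<in> {0..1}" for S and h :: "real \<Rightarrow> real"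
    using that continuous_map_from_subtopology[OF continuous_map_fst]
    by (auto simp: continuous_map_pairwise o_def continuous_map_in_subtopology Pi_iff)
  let ?S = "{z \<in> topspace ?Y. snd z \<le> 1/2}" and ?T = "{z \<in> topspace ?Y. 1/2 \<le> snd z}"
  have c: "continuous_map (subtopology ?Y S) euclideanreal snd" for S
    by (rule continuous_map_from_subtopology[OF snd])
  have "continuous_map (subtopology ?Y ?S) ?Y (\<lambda>z. (fst z, 2 * snd z))"
    by (rule reparam) (auto intro!: continuous_intros c)
  from continuous_map_compose[OF this P]
  show "continuous_map (subtopology ?Y ?S) X (\<lambda>z. P (fst z) (2 * snd z))" by (simp add: o_def)
  have "continuous_map (subtopology ?Y ?T) ?Y (\<lambda>z. (fst z, 2 * snd z - 1))"
    by (rule reparam) (auto intro!: continuous_intros c)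
  from continuous_map_compose[OF this Q]
  show "continuous_map (subtopology ?Y ?T) X (\<lambda>z. Q (fst z) (2 * snd z - 1))" by (simp add: o_def)
qed (use assms(3) in \<open>auto simp: mult.commute\<close>)

lemma Eilenberg_MacLane_aspherical:
  assumes "Eilenberg_MacLane_1 G X x\<^sub>0"
  shows "aspherical X"
  unfolding aspherical_def
proof (intro allI impI)
  fix n \<sigma> assume n: "(2::nat) \<le> n" and \<sigma>: "continuous_map (nsphere n) X \<sigma>"
  have EM: "path_connected_space X" "x\<^sub>0 \<in> topspace X" "homotopy_classes n X x\<^sub>0 = {sphere_class n X x\<^sub>0 (\<lambda>_. x\<^sub>0)}"
    using assms n by (auto simp: Eilenberg_MacLane_1_def)
  have "\<sigma> sphere_base \<in> topspace X"
    using continuous_map_image_subset_topspace[OF \<sigma>] sphere_base_in_unit_sphere[of n] by (auto simp: nsphere_eq_top_of_set)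
  then obtain q where q: "path_between X (\<sigma> sphere_base) x\<^sub>0 q"
    using EM unfolding path_connected_space_def path_between_def by blast
  have "homotopic_with (\<lambda>_. True) (nsphere n) X \<alpha> (\<lambda>_. x\<^sub>0)" if "based_map (nsphere n) sphere_base X x\<^sub>0 \<alpha>" for \<alpha>
  proof -
    have "sphere_class n X x\<^sub>0 \<alpha> \<in> homotopy_classes n X x\<^sub>0" using that by (simp add: homotopy_classes_def)
    then have "sphere_class n X x\<^sub>0 \<alpha> = sphere_class n X x\<^sub>0 (\<lambda>_. x\<^sub>0)" using EM(3) by simp
    moreover have "based_map (nsphere n) sphere_base X x\<^sub>0 (\<lambda>_. x\<^sub>0)" using EM(2) by (simp add: based_map_def)
    ultimately have "based_homotopic (nsphere n) sphere_base X x\<^sub>0 \<alpha> (\<lambda>_. x\<^sub>0)"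
      using sphere_class_eq_iff[OF that] by simp
    then show ?thesis unfolding based_homotopic_def by (rule homotopic_with_mono) simp
  qed
  from sphere_map_nullhomotopic_free[OF \<sigma> q this]
  show "\<exists>c. homotopic_with (\<lambda>_. True) (nsphere n) X \<sigma> (\<lambda>_. c)" by blast
qed

text \<open>The square \<open>(s, t) \<mapsto> F (p s, t)\<close>, where \<open>t\<close> runs around the circle, shows that the loops \<open>F (a\<^sub>0, -)\<close> and
  \<open>F (p -, 1)\<close> commute. Restricting the homotopy on the wedge to the two circles replaces them by \<open>\<alpha>\<close> and
  \<open>f \<circ> p\<close>.\<close>

lemma Gottlieb_imp_conjugate_along:
  assumes f: "based_map A a\<^sub>0 X x\<^sub>0 f" and a\<^sub>0: "a\<^sub>0 \<in> topspace A"
    and \<alpha>: "based_map (nsphere 1) sphere_base X x\<^sub>0 \<alpha>"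
    and c: "sphere_class 1 X x\<^sub>0 \<alpha> \<in> Gottlieb 1 A a\<^sub>0 X x\<^sub>0 f"
    and p: "path_between A a\<^sub>0 a\<^sub>0 p"
  shows "conjugate_along X (f \<circ> p) (\<alpha> \<circ> circle_point) (\<alpha> \<circ> circle_point)"
proof -
  let ?W = "wedge A a\<^sub>0 (nsphere 1) sphere_base"
  obtain \<alpha>' F where \<alpha>': "based_homotopic (nsphere 1) sphere_base X x\<^sub>0 \<alpha> \<alpha>'"
    and F: "continuous_map (prod_topology A (nsphere 1)) X F"
    and hom: "homotopic_with (\<lambda>h. h (a\<^sub>0, sphere_base) = x\<^sub>0) ?W X F (wedge_map sphere_base f \<alpha>')"
    using c by (auto simp: Gottlieb_def sphere_class_def based_homotopic_def)
  have b: "sphere_base \<in> topspace (nsphere 1)" using circle_point_in[of 0] by simp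
  have ends: "p 0 = a\<^sub>0" "p 1 = a\<^sub>0" and pc: "continuous_map (top_of_set {0..1}) A p"
    using p by (auto simp: path_between_def pathin_def)
  have cp: "continuous_map (top_of_set {0..1}) (nsphere 1) circle_point"
    by (rule quotient_imp_continuous_map[OF quotient_map_circle_point])
  have F0: "F (a\<^sub>0, sphere_base) = x\<^sub>0" using homotopic_with_imp_property[OF hom] by simp
  have along: "path_homotopic X (F \<circ> w) (wedge_map sphere_base f \<alpha>' \<circ> w)"
    if w: "continuous_map (top_of_set {0..1}) ?W w" "w 0 = (a\<^sub>0, sphere_base)" "w 1 = (a\<^sub>0, sphere_base)" for w
    unfolding path_homotopic_def
    by (rule homotopic_with_compose_continuous_map_right[OF hom w(1)]) (simp add: w F0)
  let ?a = "\<lambda>t. F (a\<^sub>0, circle_point t)" and ?b = "\<lambda>s. F (p s, sphere_base)"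
  have "continuous_map (top_of_set {0..1}) ?W (\<lambda>t. (a\<^sub>0, circle_point t))"
    unfolding wedge_def continuous_map_in_subtopology
    using a\<^sub>0 cp circle_point_in by (auto simp: continuous_map_pairwise o_def)
  from along[OF this] have "path_homotopic X ?a (wedge_map sphere_base f \<alpha>' \<circ> (\<lambda>t. (a\<^sub>0, circle_point t)))"
    by (simp add: o_def)
  moreover have "wedge_map sphere_base f \<alpha>' \<circ> (\<lambda>t. (a\<^sub>0, circle_point t)) = \<alpha>' \<circ> circle_point"
    using f based_homotopic_imp_based_map(2)[OF \<alpha>'] by (intro ext) (simp add: wedge_map_def based_map_def)
  ultimately have a: "path_homotopic X ?a (\<alpha> \<circ> circle_point)"
    using \<alpha>' based_homotopic_circle_iff[OF \<alpha>] path_homotopic_trans path_homotopic_sym by metis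
  have "continuous_map (top_of_set {0..1}) ?W (\<lambda>s. (p s, sphere_base))"
    unfolding wedge_def continuous_map_in_subtopology
    using pc b continuous_map_image_subset_topspace[OF pc] by (auto simp: continuous_map_pairwise o_def)
  from along[OF this] have b: "path_homotopic X ?b (f \<circ> p)"
    using ends by (simp add: o_def wedge_map_def)
  have ab: "path_homotopic X (?a \<Zsemi> ?b) (?b \<Zsemi> ?a)"
  proof (rule square_imp_path_homotopic)
    have "continuous_map (prod_topology (top_of_set {0..1}) (top_of_set {0..1})) (prod_topology A (nsphere 1)) (\<lambda>(s, t). (p s, circle_point t))"
      unfolding continuous_map_prod_top using pc cp by blast
    from continuous_map_compose[OF this F]
    show "continuous_map (top_of_set ({0..1} \<times> {0..1})) X (\<lambda>z. F (p (fst z), circle_point (snd z)))"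
      by (simp add: prod_topology_subtopology_eu o_def case_prod_beta)
  qed (simp_all add: ends)
  have ab': "path_homotopic X (?a \<Zsemi> ?b) ((\<alpha> \<circ> circle_point) \<Zsemi> (f \<circ> p))"
    by (rule path_homotopic_join[OF a b]) (simp add: ends)
  have ba': "path_homotopic X (?b \<Zsemi> ?a) ((f \<circ> p) \<Zsemi> (\<alpha> \<circ> circle_point))"
    by (rule path_homotopic_join[OF b a]) (simp add: ends)
  show ?thesis
    unfolding conjugate_along_def
    by (rule path_homotopic_trans[OF path_homotopic_trans[OF path_homotopic_sym[OF ab'] ab] ba'])
qed

lemma CW_complex_cell_structure:
  assumes "CW_complex C"
  obtains E d \<Phi> where "cell_structure C E d \<Phi>"
proof -
  from assms obtain E and d :: "'a set \<Rightarrow> nat" and \<Phi> :: "'a set \<Rightarrow> (nat \<Rightarrow> real) \<Rightarrow> 'a" where *: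
    "Hausdorff_space C" "pairwise disjnt E" "\<Union>E = topspace C"
    "\<forall>e\<in>E. continuous_map (disc (d e)) C (\<Phi> e) \<and>
             homeomorphic_map (subtopology (disc (d e)) (disc_interior (d e))) (subtopology C e) (\<Phi> e)"
    "\<forall>e\<in>E. \<exists>F. finite F \<and> F \<subseteq> E \<and> (\<forall>c\<in>F. d c < d e) \<and> \<Phi> e ` disc_boundary (d e) \<subseteq> \<Union>F"
    "\<forall>S. S \<subseteq> topspace C \<longrightarrow> (closedin C S \<longleftrightarrow>
            (\<forall>e\<in>E. closedin (disc (d e)) {x \<in> topspace (disc (d e)). \<Phi> e x \<in> S}))"
    unfolding CW_complex_def by (elim conjE exE)
  have "cell_structure C E d \<Phi>"
    by unfold_locales (use * in \<open>simp_all\<close>)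
  then show thesis by (rule that)
qed

text \<open>The representatives at \<open>x\<close> are the loops conjugate to \<open>l\<^sub>0\<close> along \<open>f \<circ> p\<close> for every path \<open>p\<close> in \<open>A\<close> from \<open>a\<^sub>0\<close>
  to \<open>k x\<close>. They exist because two such paths differ by a loop of \<open>A\<close>, along which \<open>l\<^sub>0\<close> is conjugate to
  itself. Accessing points through paths in \<open>A\<close> rather than in \<open>C\<close> keeps the base point of \<open>C\<close> out of the
  argument.\<close>

lemma conjugate_loop_family:
  assumes CW: "CW_complex C" and asph: "aspherical X" 
    and A: "path_connected_space A" "a\<^sub>0 \<in> topspace A"
    and f: "continuous_map A X f" and k: "continuous_map C A k"
    and l\<^sub>0: "path_between X (f a\<^sub>0) (f a\<^sub>0) l\<^sub>0"
    and central: "\<And>p. path_between A a\<^sub>0 a\<^sub>0 p \<Longrightarrow> conjugate_along X (f \<circ> p) l\<^sub>0 l\<^sub>0"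
  obtains G where "continuous_map (prod_topology C (top_of_set {0..1})) X G"
    "\<And>x. x \<in> topspace C \<Longrightarrow> path_between X (f (k x)) (f (k x)) (\<lambda>t. G (x, t))"
    "\<And>x p. x \<in> topspace C \<Longrightarrow> path_between A a\<^sub>0 (k x) p \<Longrightarrow> conjugate_along X (f \<circ> p) l\<^sub>0 (\<lambda>t. G (x, t))"
proof -
  obtain E d \<Phi> where cs: "cell_structure C E d \<Phi>" using CW by (rule CW_complex_cell_structure)
  define L where "L x l \<longleftrightarrow> path_between X (f (k x)) (f (k x)) l \<and>
    (\<forall>p. path_between A a\<^sub>0 (k x) p \<longrightarrow> conjugate_along X (f \<circ> p) l\<^sub>0 l)" for x l
  have kx: "k x \<in> topspace A" if "x \<in> topspace C" for x 
    using continuous_map_image_subset_topspace[OF k] that by blast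
  have access: "\<exists>p. path_between A a\<^sub>0 (k x) p" if "x \<in> topspace C" for x
    using A kx[OF that] unfolding path_connected_space_def path_between_def by blast
  have "conjugation_section C E d \<Phi> X (f \<circ> k) L"
  proof (intro conjugation_section.intro cs conjugation_section_axioms.intro)
    show "continuous_map C X (f \<circ> k)" by (rule continuous_map_compose[OF k f])
    show "aspherical X" by fact
    show "path_between X ((f \<circ> k) x) ((f \<circ> k) x) l" if "L x l" for x l using that by (simp add: L_def)
    show "\<exists>l. L x l" if x: "x \<in> topspace C" for x
    proof -
      obtain p\<^sub>0 where p0: "path_between A a\<^sub>0 (k x) p\<^sub>0" using access[OF x] by blast
      note fp0 = path_between_comp[OF p0 f]
      define l where "l = path_reverse (f \<circ> p\<^sub>0) \<Zsemi> (l\<^sub>0 \<Zsemi> (f \<circ> p\<^sub>0))"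
      have l: "path_between X (f (k x)) (f (k x)) l"
        unfolding l_def by (intro path_between_join[OF path_between_reverse[OF fp0]] path_between_join[OF l\<^sub>0 fp0])
      have c0: "conjugate_along X (f \<circ> p\<^sub>0) l\<^sub>0 l" unfolding l_def by (rule conjugate_along_exists[OF fp0 l\<^sub>0])
      have "conjugate_along X (f \<circ> p) l\<^sub>0 l" if p: "path_between A a\<^sub>0 (k x) p" for p
      proof -
        note fp = path_between_comp[OF p f]
        have loop: "path_between A a\<^sub>0 a\<^sub>0 (p \<Zsemi> path_reverse p\<^sub>0)"
          by (rule path_between_join[OF p path_between_reverse[OF p0]])
        have "conjugate_along X ((f \<circ> (p \<Zsemi> path_reverse p\<^sub>0)) \<Zsemi> (f \<circ> p\<^sub>0)) l\<^sub>0 l"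
          by (rule conjugate_along_join[OF central[OF loop] c0 path_between_comp[OF loop f] fp0 l\<^sub>0 l\<^sub>0 l])
        moreover have "path_homotopic X ((f \<circ> (p \<Zsemi> path_reverse p\<^sub>0)) \<Zsemi> (f \<circ> p\<^sub>0)) (f \<circ> p)"
          unfolding comp_path_join comp_path_reverse by (rule path_homotopic_cancel_reverse[OF fp fp0])
        ultimately show ?thesis
          by (rule conjugate_along_homotopic[OF _ _ path_between_join[OF path_between_comp[OF loop f] fp0] l\<^sub>0 l])
      qed
      then show ?thesis using l by (auto simp: L_def)
    qed
    show "path_homotopic X (l \<Zsemi> ((f \<circ> k) \<circ> e)) (((f \<circ> k) \<circ> e) \<Zsemi> l')"
      if e: "path_between C x y e" and l: "L x l" and l': "L y l'" for x y e l l'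
    proof -
      note ke = path_between_comp[OF e k]
      obtain p where p: "path_between A a\<^sub>0 (k x) p" using access path_between_topspace(1)[OF e] by blast
      have "conjugate_along X (f \<circ> (p \<Zsemi> (k \<circ> e))) l\<^sub>0 l'"
        using l' path_between_join[OF p ke] by (simp add: L_def)
      then have "conjugate_along X ((f \<circ> p) \<Zsemi> (f \<circ> (k \<circ> e))) l\<^sub>0 l'" by (simp only: comp_path_join)
      moreover have "conjugate_along X (f \<circ> p) l\<^sub>0 l" using l p by (simp add: L_def)
      ultimately have "conjugate_along X (f \<circ> (k \<circ> e)) l l'"
        using l l' unfolding L_def
        by (intro conjugate_along_cancel[OF _ _ path_between_comp[OF p f] path_between_comp[OF ke f] l\<^sub>0]) auto
      then show ?thesis by (simp add: conjugate_along_def comp_assoc)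
    qed
    show "L y l'" if e: "path_between C x y e" and l: "L x l" and l': "path_between X ((f \<circ> k) y) ((f \<circ> k) y) l'"
      and h: "path_homotopic X (l \<Zsemi> ((f \<circ> k) \<circ> e)) (((f \<circ> k) \<circ> e) \<Zsemi> l')" for x y e l l'
    proof -
      note ke = path_between_comp[OF e k]
      note fke = path_between_comp[OF ke f] and rke = path_between_reverse[OF ke]
      have ll: "path_between X (f (k x)) (f (k x)) l" using l by (simp add: L_def)
      have ll': "path_between X (f (k y)) (f (k y)) l'" using l' by simp
      have c: "conjugate_along X (f \<circ> (k \<circ> e)) l l'" using h by (simp add: conjugate_along_def comp_assoc)
      have "conjugate_along X (f \<circ> p) l\<^sub>0 l'" if p: "path_between A a\<^sub>0 (k y) p" for p
      proof -
        note q = path_between_join[OF p rke]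
        have "conjugate_along X (f \<circ> (p \<Zsemi> path_reverse (k \<circ> e))) l\<^sub>0 l" using l q by (simp add: L_def)
        from conjugate_along_join[OF this c path_between_comp[OF q f] fke l\<^sub>0 ll ll']
        have "conjugate_along X ((f \<circ> (p \<Zsemi> path_reverse (k \<circ> e))) \<Zsemi> (f \<circ> (k \<circ> e))) l\<^sub>0 l'" .
        moreover have "path_homotopic X ((f \<circ> (p \<Zsemi> path_reverse (k \<circ> e))) \<Zsemi> (f \<circ> (k \<circ> e))) (f \<circ> p)"
          unfolding comp_path_join comp_path_reverse
          by (rule path_homotopic_cancel_reverse[OF path_between_comp[OF p f] fke])
        ultimately show ?thesis
          by (rule conjugate_along_homotopic[OF _ _ path_between_join[OF path_between_comp[OF q f] fke] l\<^sub>0 ll'])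
      qed
      then show ?thesis using ll' by (simp add: L_def)
    qed
  qed
  from conjugation_section.global_section[OF this]
  obtain G where G: "continuous_map (prod_topology C (top_of_set {0..1})) X G" "\<forall>x\<in>topspace C. L x (\<lambda>t. G (x, t))"
    by blast
  show thesis by (rule that[OF G(1)]) (use G(2) in \<open>auto simp: L_def\<close>)
qed

text \<open>The family over \<open>C\<close> has its loop over \<open>h b\<close> based at \<open>f (k (h b))\<close>. Conjugating with \<open>track b\<close>, the path to
  \<open>f b\<close> given by the homotopy \<open>K\<close>, yields loops \<open>F\<^sub>0 b\<close> based exactly at \<open>f b\<close>; and over \<open>a\<^sub>0\<close> the two
  conjugations, by the section and by the track, cancel.\<close>

lemma conjugate_along_imp_Gottlieb:
  assumes CW: "CW_complex C" "A homotopy_equivalent_space C" and asph: "aspherical X" 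
    and A: "path_connected_space A" "a\<^sub>0 \<in> topspace A"
    and f: "based_map A a\<^sub>0 X x\<^sub>0 f" 
    and \<alpha>: "based_map (nsphere 1) sphere_base X x\<^sub>0 \<alpha>"
    and central: "\<And>p. path_between A a\<^sub>0 a\<^sub>0 p \<Longrightarrow> conjugate_along X (f \<circ> p) (\<alpha> \<circ> circle_point) (\<alpha> \<circ> circle_point)"
  shows "sphere_class 1 X x\<^sub>0 \<alpha> \<in> Gottlieb 1 A a\<^sub>0 X x\<^sub>0 f"
proof -
  let ?I = "top_of_set {0..1::real}" and ?a = "\<alpha> \<circ> circle_point"
  have fc: "continuous_map A X f" and fa: "f a\<^sub>0 = x\<^sub>0" using f by (auto simp: based_map_def)
  obtain h k where h: "continuous_map A C h" and k: "continuous_map C A k" and kh: "homotopic_with (\<lambda>_. True) A A (k \<circ> h) id"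
    using CW(2) unfolding homotopy_equivalent_space_def by blast
  obtain K where K: "continuous_map (prod_topology ?I A) A K" "\<And>a. K (0, a) = k (h a)" "\<And>a. K (1, a) = a"
    using kh unfolding homotopic_with_def by auto
  have a: "path_between X (f a\<^sub>0) (f a\<^sub>0) ?a" using \<alpha> unfolding based_map_circle_iff fa .
  obtain G where G: "continuous_map (prod_topology C ?I) X G"
    "\<And>x. x \<in> topspace C \<Longrightarrow> path_between X (f (k x)) (f (k x)) (\<lambda>t. G (x, t))"
    "\<And>x p. x \<in> topspace C \<Longrightarrow> path_between A a\<^sub>0 (k x) p \<Longrightarrow> conjugate_along X (f \<circ> p) ?a (\<lambda>t. G (x, t))"
    using conjugate_loop_family[OF CW(1) asph A fc k a central] by blast
  have hA: "h b \<in> topspace C" if "b \<in> topspace A" for b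
    using continuous_map_image_subset_topspace[OF h] that by blast
  define track where "track b = (\<lambda>s. f (K (s, b)))" for b
  define F\<^sub>0 where "F\<^sub>0 b = path_reverse (track b) \<Zsemi> ((\<lambda>t. G (h b, t)) \<Zsemi> track b)" for b
  have track: "continuous_map (prod_topology A ?I) X (\<lambda>z. track (fst z) (snd z))"
  proof -
    have "continuous_map (prod_topology A ?I) (prod_topology ?I A) (\<lambda>z. (snd z, fst z))"
      by (intro continuous_map_pairedI continuous_map_fst continuous_map_snd)
    from continuous_map_compose[OF continuous_map_compose[OF this K(1)] fc] show ?thesis by (simp add: track_def o_def)
  qed
  have rev: "continuous_map (prod_topology A ?I) X (\<lambda>z. path_reverse (track (fst z)) (snd z))"
  proof -
    have "continuous_map ?I ?I (\<lambda>t. 1 - t)" by (auto simp: continuous_map_in_subtopology intro!: continuous_intros)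
    then have "continuous_map (prod_topology A ?I) (prod_topology A ?I) (\<lambda>z. (fst z, 1 - snd z))"
      by (intro continuous_map_pairedI continuous_map_fst continuous_map_compose[OF continuous_map_snd, unfolded o_def])
    from continuous_map_compose[OF this track] show ?thesis by (simp add: path_reverse_def o_def)
  qed
  have mid: "continuous_map (prod_topology A ?I) X (\<lambda>z. G (h (fst z), snd z))"
  proof -
    have "continuous_map (prod_topology A ?I) (prod_topology C ?I) (\<lambda>z. (h (fst z), snd z))"
      by (intro continuous_map_pairedI continuous_map_snd continuous_map_compose[OF continuous_map_fst h, unfolded o_def])
    from continuous_map_compose[OF this G(1)] show ?thesis by (simp add: o_def)
  qed
  have Gends: "G (h b, 0) = f (k (h b))" "G (h b, 1) = f (k (h b))" if "b \<in> topspace A" for b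
    using G(2)[OF hA[OF that]] by (auto simp: path_between_def)
  have F0: "continuous_map (prod_topology A ?I) X (\<lambda>z. F\<^sub>0 (fst z) (snd z))"
    unfolding F\<^sub>0_def
    by (intro path_join_family[of A X "\<lambda>b. path_reverse (track b)" "\<lambda>b. (\<lambda>t. G (h b, t)) \<Zsemi> track b"] rev
        path_join_family[of A X "\<lambda>b t. G (h b, t)" track] mid track) (auto simp: Gends track_def K)
  have F0_ends: "F\<^sub>0 b 0 = f b" "F\<^sub>0 b 1 = f b" for b by (auto simp: F\<^sub>0_def track_def K)
  have "\<exists>F. continuous_map (prod_topology A (nsphere 1)) X F \<and>
      (\<forall>z\<in>topspace (prod_topology A ?I). F ((\<lambda>(a, t). (a, circle_point t)) z) = F\<^sub>0 (fst z) (snd z))"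
  proof (rule quotient_map_lift[OF quotient_map_id_times_circle_point F0], intro ballI impI)
    fix z w assume zw: "z \<in> topspace (prod_topology A ?I)" "w \<in> topspace (prod_topology A ?I)"
      "(\<lambda>(a, t). (a, circle_point t)) z = (\<lambda>(a, t). (a, circle_point t)) w"
    then have "fst z = fst w" "circle_point (snd z) = circle_point (snd w)" "snd z \<in> {0..1}" "snd w \<in> {0..1}"
      by (auto simp: case_prod_beta mem_Times_iff)
    then show "F\<^sub>0 (fst z) (snd z) = F\<^sub>0 (fst w) (snd w)"
      using circle_point_eq[of "snd z" "snd w"] F0_ends by auto
  qed
  then obtain F where F: "continuous_map (prod_topology A (nsphere 1)) X F"
    "\<And>b t. b \<in> topspace A \<Longrightarrow> t \<in> {0..1} \<Longrightarrow> F (b, circle_point t) = F\<^sub>0 b t" by fastforce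
  have F_base: "F (b, sphere_base) = f b" if "b \<in> topspace A" for b
    using F(2)[OF that, of 0] F0_ends by simp
  define \<alpha>' where "\<alpha>' = (\<lambda>z. F (a\<^sub>0, z))"
  have \<alpha>': "based_map (nsphere 1) sphere_base X x\<^sub>0 \<alpha>'"
    unfolding based_map_def \<alpha>'_def
    using continuous_map_compose[OF _ F(1), of "nsphere 1" "\<lambda>z. (a\<^sub>0, z)"] A(2) F_base[OF A(2)] fa
    by (simp add: o_def continuous_map_pairwise)
  have same_class: "sphere_class 1 X x\<^sub>0 \<alpha> = sphere_class 1 X x\<^sub>0 \<alpha>'"
  proof -
    define q where "q = (\<lambda>s. K (s, a\<^sub>0))"
    have q: "path_between A (k (h a\<^sub>0)) a\<^sub>0 q"
      using continuous_map_compose[OF _ K(1), of ?I "\<lambda>s. (s, a\<^sub>0)"] A(2)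
      by (simp add: path_between_def pathin_def q_def K o_def continuous_map_pairwise)
    note rq = path_between_reverse[OF q] and fq = path_between_comp[OF q fc] and Gl = G(2)[OF hA[OF A(2)]]
    have "conjugate_along X (path_reverse (f \<circ> q)) ?a (\<lambda>t. G (h a\<^sub>0, t))"
      using G(3)[OF hA[OF A(2)] rq] by (simp add: comp_path_reverse)
    from conjugate_along_reverse[OF this path_between_reverse[OF fq] a Gl]
    have "path_homotopic X ((\<lambda>t. G (h a\<^sub>0, t)) \<Zsemi> (f \<circ> q)) ((f \<circ> q) \<Zsemi> ?a)"
      by (simp add: conjugate_along_def)
    from path_homotopic_join_right[OF this path_between_reverse[OF fq] path_between_join[OF Gl fq]]
    have "path_homotopic X (F\<^sub>0 a\<^sub>0) (path_reverse (f \<circ> q) \<Zsemi> ((f \<circ> q) \<Zsemi> ?a))"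
      by (simp add: F\<^sub>0_def track_def q_def o_def)
    also have "path_homotopic X \<dots> ?a" by (rule path_homotopic_reverse_cancel[OF fq a])
    finally have "path_homotopic X (\<alpha>' \<circ> circle_point) ?a"
      by (rule path_homotopic_cong) (use F(2) A(2) in \<open>auto simp: \<alpha>'_def\<close>)
    then show ?thesis using loop_class_eq_iff[OF \<alpha> \<alpha>'] path_homotopic_sym by blast
  qed
  have "based_homotopic (wedge A a\<^sub>0 (nsphere 1) sphere_base) (a\<^sub>0, sphere_base) X x\<^sub>0 F (wedge_map sphere_base f \<alpha>')"
    unfolding based_homotopic_def
  proof (rule homotopic_with_equal)
    show "F (a\<^sub>0, sphere_base) = x\<^sub>0" using F_base[OF A(2)] fa by simp
    show "wedge_map sphere_base f \<alpha>' (a\<^sub>0, sphere_base) = x\<^sub>0" using fa by (simp add: wedge_map_def)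
    show "continuous_map (wedge A a\<^sub>0 (nsphere 1) sphere_base) X F"
      unfolding wedge_def by (rule continuous_map_from_subtopology[OF F(1)])
    show "F z = wedge_map sphere_base f \<alpha>' z" if "z \<in> topspace (wedge A a\<^sub>0 (nsphere 1) sphere_base)" for z
      using that F_base A(2) by (auto simp: wedge_def wedge_map_def \<alpha>'_def)
  qed
  then show ?thesis
    using \<alpha>' F(1) sphere_class_self[OF \<alpha>'] unfolding same_class Gottlieb_def homotopy_classes_def by blast
qed

theorem proposition1p4:
  fixes \<pi> :: "('g, 'm) monoid_scheme"
    and A :: "'a topology" and a\<^sub>0 :: 'a and CA :: "'c topology"
    and X :: "'b topology" and x\<^sub>0 :: 'b and CX :: "'d topology"
    and f :: "'a \<Rightarrow> 'b"
    and \<phi> :: "((nat \<Rightarrow> real) \<Rightarrow> 'b) set \<Rightarrow> 'g"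
  assumes "group \<pi>"
    and "path_connected_space A" and "a\<^sub>0 \<in> topspace A"
    and "CW_complex CA" and "A homotopy_equivalent_space CA"
    and "Eilenberg_MacLane_1 \<pi> X x\<^sub>0"
    and "CW_complex CX" and "X homotopy_equivalent_space CX"
    and "\<phi> \<in> iso (fundamental_group X x\<^sub>0) \<pi>"
    and "based_map A a\<^sub>0 X x\<^sub>0 f"
  shows "\<phi> ` Gottlieb 1 A a\<^sub>0 X x\<^sub>0 f =
         centralizer \<pi> (\<phi> ` (induced_hom X x\<^sub>0 f ` carrier (fundamental_group A a\<^sub>0)))"
proof -
  let ?P = "fundamental_group X x\<^sub>0"
  let ?S = "induced_hom X x\<^sub>0 f ` carrier (fundamental_group A a\<^sub>0)"
  note f = \<open>based_map A a\<^sub>0 X x\<^sub>0 f\<close>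
  have hom: "\<phi> (U \<otimes>\<^bsub>?P\<^esub> V) = \<phi> U \<otimes>\<^bsub>\<pi>\<^esub> \<phi> V" if "U \<in> carrier ?P" "V \<in> carrier ?P" for U V
    using \<open>\<phi> \<in> iso ?P \<pi>\<close> that by (auto simp: iso_def hom_def)
  have bij: "inj_on \<phi> (carrier ?P)" "\<phi> ` carrier ?P = carrier \<pi>"
    using \<open>\<phi> \<in> iso ?P \<pi>\<close> by (auto simp: iso_def bij_betw_def)
  have closed: "U \<otimes>\<^bsub>?P\<^esub> V \<in> carrier ?P" if "U \<in> carrier ?P" "V \<in> carrier ?P" for U V
    using that fundamental_group_mult loop_concat_based(1) unfolding carrier_fundamental_group by metis
  have S_eq: "?S = (\<lambda>\<beta>. sphere_class 1 X x\<^sub>0 (f \<circ> \<beta>)) ` {\<beta>. based_map (nsphere 1) sphere_base A a\<^sub>0 \<beta>}"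
  proof -
    have "carrier (fundamental_group A a\<^sub>0) = sphere_class 1 A a\<^sub>0 ` {\<beta>. based_map (nsphere 1) sphere_base A a\<^sub>0 \<beta>}"
      by (simp only: fundamental_group_def homotopy_classes_def partial_object.simps)
    then show ?thesis using induced_hom_class[OF _ f] by (simp only: image_image) (auto intro!: image_cong)
  qed
  have S: "?S \<subseteq> carrier ?P"
    unfolding S_eq
  proof (rule image_subsetI)
    fix \<beta> assume "\<beta> \<in> {\<beta>. based_map (nsphere 1) sphere_base A a\<^sub>0 \<beta>}"
    then have "based_map (nsphere 1) sphere_base X x\<^sub>0 (f \<circ> \<beta>)" using based_map_compose[OF _ f] by blast
    then show "sphere_class 1 X x\<^sub>0 (f \<circ> \<beta>) \<in> carrier ?P" unfolding carrier_fundamental_group by blast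
  qed
  have "U \<in> Gottlieb 1 A a\<^sub>0 X x\<^sub>0 f \<longleftrightarrow> (\<forall>V\<in>?S. U \<otimes>\<^bsub>?P\<^esub> V = V \<otimes>\<^bsub>?P\<^esub> U)"
    if U: "U \<in> carrier ?P" for U
  proof -
    obtain \<alpha> where \<alpha>: "based_map (nsphere 1) sphere_base X x\<^sub>0 \<alpha>" "U = sphere_class 1 X x\<^sub>0 \<alpha>"
      using U by (auto simp: carrier_fundamental_group)
    let ?central = "\<forall>p. path_between A a\<^sub>0 a\<^sub>0 p \<longrightarrow> conjugate_along X (f \<circ> p) (\<alpha> \<circ> circle_point) (\<alpha> \<circ> circle_point)"
    have "U \<in> Gottlieb 1 A a\<^sub>0 X x\<^sub>0 f \<longleftrightarrow> ?central"
      using Gottlieb_imp_conjugate_along[OF f \<open>a\<^sub>0 \<in> topspace A\<close> \<alpha>(1)]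
        conjugate_along_imp_Gottlieb[OF \<open>CW_complex CA\<close> \<open>A homotopy_equivalent_space CA\<close>
          Eilenberg_MacLane_aspherical[OF \<open>Eilenberg_MacLane_1 \<pi> X x\<^sub>0\<close>]
          \<open>path_connected_space A\<close> \<open>a\<^sub>0 \<in> topspace A\<close> f \<alpha>(1)] \<alpha>(2) by blast
    also have "?central \<longleftrightarrow> (\<forall>\<beta>. based_map (nsphere 1) sphere_base A a\<^sub>0 \<beta> \<longrightarrow>
        conjugate_along X (f \<circ> \<beta> \<circ> circle_point) (\<alpha> \<circ> circle_point) (\<alpha> \<circ> circle_point))" (is "_ \<longleftrightarrow> ?central'")
    proof (intro iffI allI impI)
      show "conjugate_along X (f \<circ> \<beta> \<circ> circle_point) (\<alpha> \<circ> circle_point) (\<alpha> \<circ> circle_point)"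
        if "?central" "based_map (nsphere 1) sphere_base A a\<^sub>0 \<beta>" for \<beta>
        using that unfolding based_map_circle_iff comp_assoc by blast
      show "conjugate_along X (f \<circ> p) (\<alpha> \<circ> circle_point) (\<alpha> \<circ> circle_point)"
        if c: "?central'" and p: "path_between A a\<^sub>0 a\<^sub>0 p" for p
      proof -
        obtain \<beta> where \<beta>: "based_map (nsphere 1) sphere_base A a\<^sub>0 \<beta>" "\<forall>t\<in>{0..1}. \<beta> (circle_point t) = p t"
          using path_between_imp_circle_map[OF p] by blast
        have \<alpha>p: "path_between X x\<^sub>0 x\<^sub>0 (\<alpha> \<circ> circle_point)" using \<alpha>(1) by (simp only: based_map_circle_iff)
        have \<beta>p: "path_between X x\<^sub>0 x\<^sub>0 (f \<circ> \<beta> \<circ> circle_point)"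
          using based_map_compose[OF \<beta>(1) f] by (simp only: based_map_circle_iff)
        have "path_homotopic X (f \<circ> \<beta> \<circ> circle_point) (f \<circ> p)"
          by (rule path_homotopic_eq) (use \<beta>p \<beta>(2) in \<open>auto simp: path_between_def\<close>)
        then show ?thesis
          using conjugate_along_homotopic[OF _ _ \<beta>p \<alpha>p \<alpha>p] c \<beta>(1) by blast
      qed
    qed
    also have "?central' \<longleftrightarrow> (\<forall>\<beta>. based_map (nsphere 1) sphere_base A a\<^sub>0 \<beta> \<longrightarrow>
        U \<otimes>\<^bsub>?P\<^esub> sphere_class 1 X x\<^sub>0 (f \<circ> \<beta>) = sphere_class 1 X x\<^sub>0 (f \<circ> \<beta>) \<otimes>\<^bsub>?P\<^esub> U)"
      using fundamental_group_commute_iff[OF \<alpha>(1) based_map_compose[OF _ f]] \<alpha>(2) by blast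
    also have "\<dots> \<longleftrightarrow> (\<forall>V\<in>?S. U \<otimes>\<^bsub>?P\<^esub> V = V \<otimes>\<^bsub>?P\<^esub> U)"
      unfolding S_eq by blast
    finally show ?thesis .
  qed
  moreover have "Gottlieb 1 A a\<^sub>0 X x\<^sub>0 f \<subseteq> carrier ?P" by (auto simp: Gottlieb_def fundamental_group_def)
  ultimately have G: "Gottlieb 1 A a\<^sub>0 X x\<^sub>0 f = {U \<in> carrier ?P. \<forall>V\<in>?S. U \<otimes>\<^bsub>?P\<^esub> V = V \<otimes>\<^bsub>?P\<^esub> U}" by blast
  have comm: "U \<otimes>\<^bsub>?P\<^esub> V = V \<otimes>\<^bsub>?P\<^esub> U \<longleftrightarrow> \<phi> U \<otimes>\<^bsub>\<pi>\<^esub> \<phi> V = \<phi> V \<otimes>\<^bsub>\<pi>\<^esub> \<phi> U"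
    if "U \<in> carrier ?P" "V \<in> ?S" for U V
  proof -
    have V: "V \<in> carrier ?P" using that(2) S by (rule rev_subsetD)
    show ?thesis
      using inj_on_eq_iff[OF bij(1) closed[OF that(1) V] closed[OF V that(1)]]
      by (simp only: hom[OF that(1) V] hom[OF V that(1)])
  qed
  show ?thesis
    unfolding G centralizer_def bij(2)[symmetric]
  proof (intro equalityI subsetI)
    fix g assume "g \<in> \<phi> ` {U \<in> carrier ?P. \<forall>V\<in>?S. U \<otimes>\<^bsub>?P\<^esub> V = V \<otimes>\<^bsub>?P\<^esub> U}"
    then obtain U where U: "g = \<phi> U" "U \<in> carrier ?P" "\<forall>V\<in>?S. U \<otimes>\<^bsub>?P\<^esub> V = V \<otimes>\<^bsub>?P\<^esub> U" by blast
    have "g \<otimes>\<^bsub>\<pi>\<^esub> s = s \<otimes>\<^bsub>\<pi>\<^esub> g" if s: "s \<in> \<phi> ` ?S" for s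
      using s U(3) comm[OF U(2)] unfolding U(1) by (elim imageE) simp
    then show "g \<in> {g \<in> \<phi> ` carrier ?P. \<forall>s\<in>\<phi> ` ?S. g \<otimes>\<^bsub>\<pi>\<^esub> s = s \<otimes>\<^bsub>\<pi>\<^esub> g}"
      using U(1,2) by blast
  next
    fix g assume "g \<in> {g \<in> \<phi> ` carrier ?P. \<forall>s\<in>\<phi> ` ?S. g \<otimes>\<^bsub>\<pi>\<^esub> s = s \<otimes>\<^bsub>\<pi>\<^esub> g}"
    then obtain U where U: "g = \<phi> U" "U \<in> carrier ?P" "\<forall>s\<in>\<phi> ` ?S. g \<otimes>\<^bsub>\<pi>\<^esub> s = s \<otimes>\<^bsub>\<pi>\<^esub> g" by blast
    have "U \<otimes>\<^bsub>?P\<^esub> V = V \<otimes>\<^bsub>?P\<^esub> U" if V: "V \<in> ?S" for V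
      using U(3) imageI[OF V, of \<phi>] comm[OF U(2) V] unfolding U(1) by blast
    then show "g \<in> \<phi> ` {U \<in> carrier ?P. \<forall>V\<in>?S. U \<otimes>\<^bsub>?P\<^esub> V = V \<otimes>\<^bsub>?P\<^esub> U}"
      unfolding U(1) using U(2) by blast
  qed
qed

end
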